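(* Let $A\in\mathbb{R}^{m\times n}$, $b\in\mathbb{R}^m$, $c\in\mathbb{R}^n$, and let $A^\Delta\in\mathbb{R}^{m\times n}$, $b^\Delta\in\mathbb{R}^m$, $c^\Delta\in\mathbb{R}^n$ be entrywise nonnegative. Assume that $A$ has linearly independent rows, that there is $x^0\in\mathbb{R}^n$ with $Ax^0=b$ and $x^0>0$ (entrywise), and that the dual feasible set $\{y\in\mathbb{R}^m : A^Ty\le c\}$ has nonempty interior. Let $\mathcal{B}$ be the set of all optimal bases of the linear program $\min\, c^Tx$ subject to $Ax=b,\ x\ge 0$. Then $$d_w(A,b,c,A^\Delta,b^\Delta,c^\Delta)\le\max_{B\in\mathcal{B}}\ d_w(B),$$ where $$d_w(B)=|y^*(B)|^TA^\Delta x^*(B)+|y^*(B)|^Tb^\Delta+x^*(B)^Tc^\Delta,$$ and $x^*(B)$ and $y^*(B)$ are the basic optimal solution and the dual basic optimal solution corresponding to the basis $B$.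
   Context: For $A\in\mathbb{R}^{m\times n}$, $b\in\mathbb{R}^m$, $c\in\mathbb{R}^n$, let $f(A,b,c)$ denote the optimal value of $\min\, c^Tx$ subject to $Ax=b,\ x\ge0$ (with the usual extended-real conventions: $+\infty$ if infeasible, $-\infty$ if unbounded). The dual problem is $\max\, b^Ty$ subject to $A^Ty\le c$. Inequalities and absolute values of vectors and matrices are entrywise. For $\alpha\ge0$ put $\boldsymbol{A}_\alpha=\{A' : A-\alpha A^\Delta\le A'\le A+\alpha A^\Delta\}$, $\boldsymbol{b}_\alpha=\{b' : b-\alpha b^\Delta\le b'\le b+\alpha b^\Delta\}$, $\boldsymbol{c}_\alpha=\{c' : c-\alpha c^\Delta\le c'\le c+\alpha c^\Delta\}$, and define the worst case optimal value $$\overline{f}(\boldsymbol{A}_\alpha,\boldsymbol{b}_\alpha,\boldsymbol{c}_\alpha)=\max\{f(A',b',c') : A'\in\boldsymbol{A}_\alpha,\ b'\in\boldsymbol{b}_\alpha,\ c'\in\boldsymbol{c}_\alpha\}.$$ The worst-case optimal value derivative is $$d_w(A,b,c,A^\Delta,b^\Delta,c^\Delta)=\lim_{\alpha\to0^+}\frac{\overline{f}(\boldsymbol{A}_\alpha,\boldsymbol{b}_\alpha,\boldsymbol{c}_\alpha)-f(A,b,c)}{\alpha}.$$ For an index set $B\subseteq\{1,\dots,n\}$, $A_B$ denotes the restriction of $A$ to the columns indexed by $B$, and $N$ is the complement of $B$; $B$ is a basis if $A_B$ is (square and) nonsingular. A basis $B$ is optimal if $A_B^{-1}b\ge0$ and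 $c_N^T-c_B^TA_B^{-1}A_N\ge0^T$. For an optimal basis $B$, $x^*(B)$ is the vector with $x^*(B)_B=A_B^{-1}b$, $x^*(B)_N=0$, and $y^*(B)=(A_B^{T})^{-1}c_B$. *)

theory Defs
  imports "HOL-Analysis.Analysis"
begin

text \<open>
  On \<open>real ^ 'n\<close> and \<open>real ^ 'n ^ 'm\<close> the relation \<open>\<le>\<close> and the absolute value are entrywise.
  The strict order \<open><\<close> on vectors is not, so strict positivity is written out by components.
\<close>

definition lp_value :: "real ^ 'n ^ 'm \<Rightarrow> real ^ 'm \<Rightarrow> real ^ 'n \<Rightarrow> ereal" where
  "lp_value A b c = (INF x \<in> {x. A *v x = b \<and> 0 \<le> x}. ereal (c \<bullet> x))"

text \<open>
  The worst case value is a supremum in the extended reals; it is the maximum whenever the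
  maximum is attained.
\<close>

definition worst_value ::
    "real ^ 'n ^ 'm \<Rightarrow> real ^ 'm \<Rightarrow> real ^ 'n \<Rightarrow> real ^ 'n ^ 'm \<Rightarrow> real ^ 'm \<Rightarrow> real ^ 'n \<Rightarrow> real \<Rightarrow> ereal" where
  "worst_value A b c A\<Delta> b\<Delta> c\<Delta> \<alpha> =
     Sup {lp_value A' b' c' | A' b' c'.
            A' \<in> {A - \<alpha> *\<^sub>R A\<Delta> .. A + \<alpha> *\<^sub>R A\<Delta>} \<and>
            b' \<in> {b - \<alpha> *\<^sub>R b\<Delta> .. b + \<alpha> *\<^sub>R b\<Delta>} \<and>
            c' \<in> {c - \<alpha> *\<^sub>R c\<Delta> .. c + \<alpha> *\<^sub>R c\<Delta>}}"

definition worst_quotient ::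
    "real ^ 'n ^ 'm \<Rightarrow> real ^ 'm \<Rightarrow> real ^ 'n \<Rightarrow> real ^ 'n ^ 'm \<Rightarrow> real ^ 'm \<Rightarrow> real ^ 'n \<Rightarrow> real \<Rightarrow> ereal" where
  "worst_quotient A b c A\<Delta> b\<Delta> c\<Delta> \<alpha> =
     (worst_value A b c A\<Delta> b\<Delta> c\<Delta> \<alpha> - lp_value A b c) / ereal \<alpha>"

text \<open>\<open>Lim\<close> is arbitrary if there is no limit; convergence has to be stated separately.\<close>

definition worst_deriv ::
    "real ^ 'n ^ 'm \<Rightarrow> real ^ 'm \<Rightarrow> real ^ 'n \<Rightarrow> real ^ 'n ^ 'm \<Rightarrow> real ^ 'm \<Rightarrow> real ^ 'n \<Rightarrow> ereal" where
  "worst_deriv A b c A\<Delta> b\<Delta> c\<Delta> = Lim (at_right 0) (worst_quotient A b c A\<Delta> b\<Delta> c\<Delta>)"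

text \<open>
  For an index set \<open>B\<close> with as many elements as there are rows, the square matrix \<open>A\<^sub>B\<close> is formed
  by listing the columns in \<open>B\<close> along an arbitrary enumeration of \<open>B\<close> by the row index type.
  Invertibility of \<open>A\<^sub>B\<close>, the reduced costs and the two basic solutions do not depend on the choice
  of enumeration.
\<close>

definition enum_of :: "'n set \<Rightarrow> 'm::finite \<Rightarrow> 'n" where
  "enum_of B = (SOME \<sigma>. bij_betw \<sigma> UNIV B)"

definition sub_cols :: "real ^ 'n ^ 'm \<Rightarrow> 'n set \<Rightarrow> real ^ 'm ^ 'm" where
  "sub_cols A B = (\<chi> i k. A $ i $ enum_of B k)"

definition sub_vec :: "real ^ 'n \<Rightarrow> 'n set \<Rightarrow> real ^ 'm" where
  "sub_vec c B = (\<chi> k. c $ enum_of B k)"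

definition is_basis :: "real ^ 'n ^ 'm \<Rightarrow> 'n set \<Rightarrow> bool" where
  "is_basis A B \<longleftrightarrow> card B = CARD('m) \<and> invertible (sub_cols A B)"

definition optimal_basis ::
    "real ^ 'n ^ 'm \<Rightarrow> real ^ 'm \<Rightarrow> real ^ 'n \<Rightarrow> 'n set \<Rightarrow> bool" where
  "optimal_basis A b c B \<longleftrightarrow>
     is_basis A B \<and>
     0 \<le> matrix_inv (sub_cols A B) *v b \<and>
     (\<forall>j \<in> - B. 0 \<le> c $ j - ((sub_vec c B v* matrix_inv (sub_cols A B)) v* A) $ j)"

definition primal_sol :: "real ^ 'n ^ 'm \<Rightarrow> real ^ 'm \<Rightarrow> 'n set \<Rightarrow> real ^ 'n" where
  "primal_sol A b B =
     (\<chi> j. if j \<in> B then (matrix_inv (sub_cols A B) *v b) $ inv (enum_of B) j else 0)"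

definition dual_sol :: "real ^ 'n ^ 'm \<Rightarrow> real ^ 'n \<Rightarrow> 'n set \<Rightarrow> real ^ 'm" where
  "dual_sol A c B = matrix_inv (transpose (sub_cols A B)) *v sub_vec c B"

definition basis_deriv ::
    "real ^ 'n ^ 'm \<Rightarrow> real ^ 'm \<Rightarrow> real ^ 'n \<Rightarrow> real ^ 'n ^ 'm \<Rightarrow> real ^ 'm \<Rightarrow> real ^ 'n \<Rightarrow> 'n set \<Rightarrow> real" where
  "basis_deriv A b c A\<Delta> b\<Delta> c\<Delta> B =
     \<bar>dual_sol A c B\<bar> \<bullet> (A\<Delta> *v primal_sol A b B)
     + \<bar>dual_sol A c B\<bar> \<bullet> b\<Delta>
     + primal_sol A b B \<bullet> c\<Delta>"

end

theory Submission
  imports Defs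
begin

text \<open>
  Let \<open>X\<close> and \<open>Y\<close> be the sets of optimal solutions of the primal and the dual problem and
  \<open>\<psi> x y = \<bar>y\<bar> \<bullet> (A\<Delta> *v x) + \<bar>y\<bar> \<bullet> b\<Delta> + x \<bullet> c\<Delta>\<close>. The worst case value at \<open>\<alpha>\<close> is the supremum of
  \<open>b \<bullet> y + \<alpha> * (\<bar>y\<bar> \<bullet> b\<Delta>)\<close> over all \<open>y\<close> with \<open>y v* A \<le> c + \<alpha> (c\<Delta> + \<bar>y\<bar> v* A\<Delta>)\<close>, and from this
  the derivative is \<open>max\<close> over \<open>y \<in> Y\<close> of \<open>min\<close> over \<open>x \<in> X\<close> of \<open>\<psi> x y\<close>: the upper bound by weak duality and
  compactness of dual solutions, the lower bound by following a feasible ray from \<open>y\<close>.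
  Fix a vertex \<open>x\<close> of \<open>X\<close>. As \<open>\<psi> x\<close> is convex and \<open>Y\<close> is a polytope, the derivative is at most \<open>\<psi> x y\<close> for
  some vertex \<open>y\<close> of \<open>Y\<close>, and any two such vertices belong to a common optimal basis.
\<close>

section \<open>Vectors, matrices and the entrywise order\<close>

lemma vector_matrix_mult_column:
  fixes M :: "real ^ 'n ^ 'm"
  shows "(y v* M) $ j = y \<bullet> column j M"
  by (simp add: vector_matrix_mult_def column_def inner_vec_def mult.commute)

lemma inner_mono_nonneg:
  fixes u v x :: "real ^ 'n"
  assumes "u \<le> v" and "0 \<le> x"
  shows "u \<bullet> x \<le> v \<bullet> x"
  using assms by (auto simp: inner_vec_def less_eq_vec_def intro!: sum_mono mult_right_mono)

lemma tendsto_vector_matrix_mult: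
  fixes A :: "real ^ 'n ^ 'm"
  assumes "(f \<longlongrightarrow> y) F" and "(A' \<longlongrightarrow> A) F"
  shows "((\<lambda>k. f k v* A' k) \<longlongrightarrow> y v* A) F"
proof (rule vec_tendstoI)
  fix j
  have "((\<lambda>k. A' k $ i $ j * f k $ i) \<longlongrightarrow> A $ i $ j * y $ i) F" for i
    by (intro tendsto_mult tendsto_vec_nth assms)
  then have "((\<lambda>k. \<Sum>i\<in>UNIV. A' k $ i $ j * f k $ i) \<longlongrightarrow> (\<Sum>i\<in>UNIV. A $ i $ j * y $ i)) F"
    by (intro tendsto_sum)
  then show "((\<lambda>k. (f k v* A' k) $ j) \<longlongrightarrow> (y v* A) $ j) F"
    by (simp add: vector_matrix_mult_def mult.commute)
qed

lemma abs_vec_nth: "\<bar>x :: real ^ 'n\<bar> $ i = \<bar>x $ i\<bar>"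
  by (simp add: abs_vec_def)

lemma abs_vec_nonneg: "0 \<le> \<bar>x :: real ^ 'n\<bar>"
  by (simp add: less_eq_vec_def abs_vec_nth)

lemma tendsto_abs_vec:
  fixes y :: "real ^ 'n"
  assumes "(f \<longlongrightarrow> y) F"
  shows "((\<lambda>k. \<bar>f k\<bar>) \<longlongrightarrow> \<bar>y\<bar>) F"
proof (rule vec_tendstoI)
  fix i
  have "((\<lambda>k. \<bar>f k $ i\<bar>) \<longlongrightarrow> \<bar>y $ i\<bar>) F"
    by (intro tendsto_rabs tendsto_vec_nth assms)
  then show "((\<lambda>k. \<bar>f k\<bar> $ i) \<longlongrightarrow> \<bar>y\<bar> $ i) F"
    by (simp add: abs_vec_nth)
qed

lemma inner_nonneg_vec:
  fixes u x :: "real ^ 'n"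
  shows "0 \<le> u \<Longrightarrow> 0 \<le> x \<Longrightarrow> 0 \<le> u \<bullet> x"
  using inner_mono_nonneg[of 0 u x] by simp

lemma matrix_mult_nonneg:
  fixes M :: "real ^ 'n ^ 'm"
  assumes "0 \<le> M" and "0 \<le> x"
  shows "0 \<le> M *v x"
  using assms by (auto simp: less_eq_vec_def matrix_vector_mult_def intro!: sum_nonneg mult_nonneg_nonneg)

lemma vector_mult_nonneg:
  fixes M :: "real ^ 'n ^ 'm"
  assumes "0 \<le> M" and "0 \<le> y"
  shows "0 \<le> y v* M"
  using assms by (auto simp: less_eq_vec_def vector_matrix_mult_def intro!: sum_nonneg mult_nonneg_nonneg)

text \<open>Each term changes by at most \<open>d $ i\<close> times the absolute value of
  \<open>y $ i\<close>; this is how absolute values of dual solutions enter the rate.\<close>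

lemma inner_abs_perturb:
  fixes u v d y :: "real ^ 'n"
  assumes "u - d \<le> v" and "v \<le> u + d"
  shows "v \<bullet> y \<le> u \<bullet> y + d \<bullet> \<bar>y\<bar>"
proof -
  have "v $ i * y $ i \<le> u $ i * y $ i + d $ i * \<bar>y $ i\<bar>" for i
  proof -
    have "\<bar>v $ i - u $ i\<bar> \<le> d $ i"
      using assms by (simp add: less_eq_vec_def abs_le_iff algebra_simps)
    then have "\<bar>v $ i - u $ i\<bar> * \<bar>y $ i\<bar> \<le> d $ i * \<bar>y $ i\<bar>"
      by (intro mult_right_mono) simp_all
    moreover have "(v $ i - u $ i) * y $ i \<le> \<bar>v $ i - u $ i\<bar> * \<bar>y $ i\<bar>"
      by (metis abs_ge_self abs_mult)
    ultimately show ?thesis by (simp add: algebra_simps)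
  qed
  then show ?thesis
    by (simp add: inner_vec_def abs_vec_nth sum_mono flip: sum.distrib)
qed

lemma matrix_inv_cancel:
  fixes M :: "real ^ 'm ^ 'm"
  assumes "invertible M"
  shows "M ** matrix_inv M = mat 1" and "matrix_inv M ** M = mat 1"
  using someI_ex[OF assms[unfolded invertible_def]] by (auto simp: matrix_inv_def)

section \<open>Duality of linear programs\<close>

text \<open>A Farkas alternative: the premise keeps \<open>(b, v)\<close> out of the cone generated
  by \<open>(0, 1)\<close> and the pairs \<open>(column j A, c $ j)\<close> with \<open>j\<close> in
  \<open>T\<close>. The cone is finitely generated, hence closed, and a hyperplane separates the
  point from it. The multiplier \<open>l\<close> belongs to the objective and may be zero.
  \<open>T\<close> will be either the set of all indices or the set of dual constraints active at an
  optimal solution.\<close>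

lemma lp_alternative:
  fixes A :: "real ^ 'n ^ 'm" and b :: "real ^ 'm" and c :: "real ^ 'n"
  assumes lt: "\<And>x. A *v x = b \<Longrightarrow> 0 \<le> x \<Longrightarrow> \<forall>j. j \<notin> T \<longrightarrow> x $ j = 0 \<Longrightarrow> v < c \<bullet> x"
  obtains y l where "0 \<le> l" and "\<forall>j\<in>T. (y v* A) $ j \<le> l * c $ j" and "l * v < b \<bullet> y"
proof -
  define K where "K = {(A *v x, c \<bullet> x + t) | x t. 0 \<le> x \<and> (\<forall>j. j \<notin> T \<longrightarrow> x $ j = 0) \<and> 0 \<le> t}"
  define G where "G = insert (0, 1) ((\<lambda>j. (column j A, c $ j)) ` T)"
  have "convex_cone K"
    unfolding convex_cone_iff
  proof (intro conjI ballI allI impI)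
    show "0 \<in> K"
      unfolding K_def by (rule CollectI, rule exI[of _ 0], rule exI[of _ 0]) (simp add: zero_prod_def)
  next
    fix p q assume "p \<in> K" "q \<in> K"
    then obtain x t x' t' where "p = (A *v x, c \<bullet> x + t)" "0 \<le> x" "\<forall>j. j \<notin> T \<longrightarrow> x $ j = 0" "0 \<le> t"
      "q = (A *v x', c \<bullet> x' + t')" "0 \<le> x'" "\<forall>j. j \<notin> T \<longrightarrow> x' $ j = 0" "0 \<le> t'"
      unfolding K_def by blast
    then show "p + q \<in> K"
      unfolding K_def
      by (intro CollectI exI[of _ "x + x'"] exI[of _ "t + t'"])
        (simp add: matrix_vector_right_distrib inner_add_right)
  next
    fix p and s :: real assume "p \<in> K" "0 \<le> s"
    then obtain x t where "p = (A *v x, c \<bullet> x + t)" "0 \<le> x" "\<forall>j. j \<notin> T \<longrightarrow> x $ j = 0" "0 \<le> t"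
      unfolding K_def by blast
    with \<open>0 \<le> s\<close> show "s *\<^sub>R p \<in> K"
      unfolding K_def
      by (intro CollectI exI[of _ "s *\<^sub>R x"] exI[of _ "s * t"])
        (simp add: matrix_vector_mult_scaleR algebra_simps scaleR_nonneg_nonneg)
  qed
  moreover have "G \<subseteq> K"
  proof
    fix p assume "p \<in> G"
    then consider "p = (0, 1)" | j where "j \<in> T" "p = (column j A, c $ j)"
      unfolding G_def by blast
    then show "p \<in> K"
    proof cases
      case 1
      then show ?thesis
        unfolding K_def by (intro CollectI exI[of _ 0] exI[of _ 1]) simp
    next
      case 2
      then show ?thesis
        unfolding K_def
        by (intro CollectI exI[of _ "axis j 1"] exI[of _ 0])
          (auto simp: matrix_vector_mult_basis inner_axis less_eq_vec_def, auto simp: axis_def)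
    qed
  qed
  ultimately have "convex_cone hull G \<subseteq> K"
    by (simp add: hull_minimal)
  moreover have "(b, v) \<notin> K"
  proof
    assume "(b, v) \<in> K"
    then obtain x t where "A *v x = b" "v = c \<bullet> x + t" "0 \<le> x" "\<forall>j. j \<notin> T \<longrightarrow> x $ j = 0" "0 \<le> t"
      unfolding K_def by blast
    with lt[of x] show False by simp
  qed
  ultimately have "(b, v) \<notin> convex_cone hull G" by blast
  moreover have "closed (convex_cone hull G)"
    unfolding G_def by (intro closed_convex_cone_hull) simp
  ultimately obtain p k where sep: "p \<bullet> (b, v) < k" "\<And>q. q \<in> convex_cone hull G \<Longrightarrow> k < p \<bullet> q"
    using separating_hyperplane_closed_point[OF convex_convex_cone_hull] by blast
  obtain z l where p: "p = (z, l)" by (cases p)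
  have "k < 0"
    using sep(2)[OF convex_cone_hull_contains_0] by simp
  have nonneg: "0 \<le> p \<bullet> q" if "q \<in> G" for q
  proof (rule ccontr)
    assume "\<not> 0 \<le> p \<bullet> q"
    then have neg: "p \<bullet> q < 0" by simp
    \<comment> \<open>This multiple of \<open>q\<close> has inner product exactly \<open>k\<close>
      with \<open>p\<close>, which the strict separation forbids.\<close>
    have "(k / (p \<bullet> q)) *\<^sub>R q \<in> convex_cone hull G"
      using that neg \<open>k < 0\<close> by (intro convex_cone_hull_mul hull_inc) (auto simp: zero_le_divide_iff)
    from sep(2)[OF this] neg show False by simp
  qed
  \<comment> \<open>The dual vector is \<open>- z\<close>, the negated first component of the
    separating normal.\<close>
  show thesis
  proof
    show "0 \<le> l" using nonneg[of "(0, 1)"] by (simp add: G_def p)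
    show "\<forall>j\<in>T. (- z v* A) $ j \<le> l * c $ j"
    proof
      fix j assume "j \<in> T"
      then have "0 \<le> z \<bullet> column j A + l * c $ j"
        using nonneg[of "(column j A, c $ j)"] by (simp add: G_def p)
      then show "(- z v* A) $ j \<le> l * c $ j"
        by (simp add: vector_matrix_mult_column)
    qed
    show "l * v < b \<bullet> - z"
      using sep(1) \<open>k < 0\<close> by (simp add: p inner_commute algebra_simps)
  qed
qed

section \<open>Weak duality and certificates for lower bounds\<close>

lemma lp_value_le: "A *v x = b \<Longrightarrow> 0 \<le> x \<Longrightarrow> lp_value A b c \<le> ereal (c \<bullet> x)"
  unfolding lp_value_def by (rule INF_lower) simp

lemma weak_duality:
  fixes A :: "real ^ 'n ^ 'm"
  assumes "y v* A \<le> c"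
  shows "ereal (b \<bullet> y) \<le> lp_value A b c"
  unfolding lp_value_def
proof (rule INF_greatest)
  fix x assume "x \<in> {x. A *v x = b \<and> 0 \<le> x}"
  then have "b \<bullet> y = (y v* A) \<bullet> x" "0 \<le> x"
    by (auto simp: dot_lmul_matrix inner_commute[of y])
  with inner_mono_nonneg[OF assms] show "ereal (b \<bullet> y) \<le> ereal (c \<bullet> x)" by simp
qed

text \<open>For \<open>l > 0\<close>, dividing \<open>y\<close> by \<open>l\<close> gives a dual
  feasible point with objective above \<open>v\<close>; \<open>l = 0\<close> certifies
  infeasibility, so it occurs only if the value is infinite.\<close>

lemma below_lp_value:
  fixes A :: "real ^ 'n ^ 'm"
  assumes "ereal v < lp_value A b c"
  obtains y l where "0 \<le> l" and "y v* A \<le> l *\<^sub>R c" and "l * v < b \<bullet> y"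
proof -
  have "v < c \<bullet> x" if "A *v x = b" "0 \<le> x" for x
    using less_le_trans[OF assms lp_value_le[OF that]] by simp
  then obtain y l where "0 \<le> l" "\<forall>j\<in>UNIV. (y v* A) $ j \<le> l * c $ j" "l * v < b \<bullet> y"
    using lp_alternative[of A b UNIV v c] by blast
  then show thesis
    using that[of l y] by (simp add: less_eq_vec_def)
qed

text \<open>Independence of the set of rows does not see repeated rows, whence the injectivity; the
  coefficients are transported to the set along the inverse of the row map.\<close>

lemma row_independent_trivial_kernel:
  fixes A :: "real ^ 'n ^ 'm"
  assumes "inj (\<lambda>i. row i A)" and "independent (range (\<lambda>i. row i A))" and "y v* A = 0"
  shows "y = 0"
proof -
  define r where "r = (\<lambda>i. row i A)"
  have "(\<Sum>i\<in>UNIV. y $ i *\<^sub>R r i) = 0"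
    using assms(3) by (simp add: vec_eq_iff vector_matrix_mult_def r_def row_def mult.commute)
  moreover have "inj r"
    using assms(1) by (simp add: r_def)
  then have "(\<Sum>w\<in>range r. y $ (inv r w) *\<^sub>R w) = (\<Sum>i\<in>UNIV. y $ i *\<^sub>R r i)"
    by (subst sum.reindex) simp_all
  ultimately have "(\<Sum>w\<in>range r. y $ (inv r w) *\<^sub>R w) = 0" by simp
  moreover have indD: "\<And>u. (\<Sum>w\<in>range r. u w *\<^sub>R w) = 0 \<Longrightarrow> \<forall>w\<in>range r. u w = 0"
    using assms(2) unfolding independent_explicit r_def by blast
  ultimately have "\<forall>w\<in>range r. y $ (inv r w) = 0" by (intro indD)
  then have "y $ i = 0" for i
  proof -
    have "y $ inv r (r i) = 0" using \<open>\<forall>w\<in>range r. y $ (inv r w) = 0\<close> by blast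
    then show ?thesis using \<open>inj r\<close> by simp
  qed
  then show ?thesis by (simp add: vec_eq_iff)
qed

text \<open>A small step along column \<open>j\<close> stays feasible and strictly increases the
  left-hand side of constraint \<open>j\<close>. For a zero column that side is constantly 0 and may
  equal \<open>c $ j\<close>.\<close>

lemma interior_dual_strict:
  fixes A :: "real ^ 'n ^ 'm"
  assumes "y \<in> interior {y. transpose A *v y \<le> c}" and "column j A \<noteq> 0"
  shows "(y v* A) $ j < c $ j"
proof -
  obtain e where e: "0 < e" "cball y e \<subseteq> {y. transpose A *v y \<le> c}"
    using assms(1) by (auto simp: mem_interior_cball)
  define s where "s = e / norm (column j A)"
  have "0 < s" using e assms(2) by (simp add: s_def)
  have "y + s *\<^sub>R column j A \<in> cball y e"
    using e assms(2) by (simp add: s_def dist_norm)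
  with e have "((y + s *\<^sub>R column j A) v* A) $ j \<le> c $ j"
    by (auto simp: less_eq_vec_def)
  moreover have "0 < s * (column j A \<bullet> column j A)"
    using \<open>0 < s\<close> assms(2) by simp
  ultimately show ?thesis
    unfolding vector_matrix_mult_column by (simp add: inner_add_left)
qed

text \<open>
  The dual solutions are homogenised by \<open>l\<close>, so that the normalised sequence always has a limit
  point; the strictly positive \<open>x0\<close> and the independent rows exclude limit points with \<open>l = 0\<close>.
\<close>

lemma dual_limit:
  fixes A :: "real ^ 'n ^ 'm" and b :: "real ^ 'm" and c :: "real ^ 'n"
  assumes inj: "inj (\<lambda>i. row i A)" and ind: "independent (range (\<lambda>i. row i A))"
    and x0: "A *v x0 = b" "\<And>j. 0 < x0 $ j"
    and lim: "A' \<longlonglongrightarrow> A" "b' \<longlonglongrightarrow> b" "c' \<longlonglongrightarrow> c" "v' \<longlonglongrightarrow> v"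
    and nz: "\<And>k. (y k, l k) \<noteq> 0" and nonneg: "\<And>k. 0 \<le> l k"
    and feas: "\<And>k. y k v* A' k \<le> l k *\<^sub>R c' k" and val: "\<And>k. l k * v' k \<le> b' k \<bullet> y k"
  obtains r z where "strict_mono r" and "\<forall>\<^sub>F k in sequentially. 0 < l (r k)"
    and "(\<lambda>k. y (r k) /\<^sub>R l (r k)) \<longlonglongrightarrow> z" and "z v* A \<le> c" and "v \<le> b \<bullet> z"
proof -
  define w where "w = (\<lambda>k. (y k, l k) /\<^sub>R norm (y k, l k))"
  have "\<forall>k. w k \<in> sphere 0 1"
    using nz by (simp add: w_def del: scaleR_Pair)
  then obtain p r where p: "p \<in> sphere 0 1" and r: "strict_mono r" and wr: "(w \<circ> r) \<longlonglongrightarrow> p"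
    using compact_sphere[of "0 :: (real ^ 'm) \<times> real" 1] unfolding compact_eq_seq_compact_metric seq_compact_def
    by metis
  define N where "N = (\<lambda>k. norm (y k, l k))"
  have N: "0 < N k" for k using nz by (simp add: N_def)
  obtain z m where zm: "p = (z, m)" by (cases p)
  have ylim: "(\<lambda>k. y (r k) /\<^sub>R N (r k)) \<longlonglongrightarrow> z"
    using tendsto_fst[OF wr] by (simp add: w_def zm N_def)
  have llim: "(\<lambda>k. l (r k) / N (r k)) \<longlonglongrightarrow> m"
    using tendsto_snd[OF wr] by (simp add: w_def zm N_def divide_inverse_commute)
  note lim' = lim[THEN LIMSEQ_subseq_LIMSEQ[OF _ r], unfolded o_def]
  have "0 \<le> m"
    using llim nonneg N by (intro LIMSEQ_le_const[OF llim]) (auto simp: less_imp_le)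
  have scaled: "(y k /\<^sub>R N k) v* A' k = (y k v* A' k) /\<^sub>R N k" for k
    by (simp add: scaleR_vector_matrix_assoc)
  have zfeas: "(z v* A) $ j \<le> m * c $ j" for j
  proof (rule LIMSEQ_le)
    show "(\<lambda>k. ((y (r k) /\<^sub>R N (r k)) v* A' (r k)) $ j) \<longlonglongrightarrow> (z v* A) $ j"
      using ylim lim'(1) by (intro tendsto_intros tendsto_vector_matrix_mult)
    show "(\<lambda>k. l (r k) / N (r k) * c' (r k) $ j) \<longlonglongrightarrow> m * c $ j"
      using llim lim'(3) by (intro tendsto_intros)
    have "((y k /\<^sub>R N k) v* A' k) $ j \<le> l k / N k * c' k $ j" for k
      using feas[of k] N[of k] unfolding scaled by (simp add: less_eq_vec_def divide_simps)
    then show "\<exists>K. \<forall>k\<ge>K. ((y (r k) /\<^sub>R N (r k)) v* A' (r k)) $ j \<le> l (r k) / N (r k) * c' (r k) $ j"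
      by blast
  qed
  have zval: "m * v \<le> b \<bullet> z"
  proof (rule LIMSEQ_le)
    show "(\<lambda>k. l (r k) / N (r k) * v' (r k)) \<longlonglongrightarrow> m * v"
      using llim lim'(4) by (intro tendsto_intros)
    show "(\<lambda>k. b' (r k) \<bullet> (y (r k) /\<^sub>R N (r k))) \<longlonglongrightarrow> b \<bullet> z"
      using ylim lim'(2) by (intro tendsto_intros)
    have "l k / N k * v' k \<le> b' k \<bullet> (y k /\<^sub>R N k)" for k
      using val[of k] N[of k] by (simp add: divide_simps)
    then show "\<exists>K. \<forall>k\<ge>K. l (r k) / N (r k) * v' (r k) \<le> b' (r k) \<bullet> (y (r k) /\<^sub>R N (r k))"
      by blast
  qed
  \<comment> \<open>For \<open>m = 0\<close> the limit satisfies \<open>z v* A \<le> 0\<close> and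
    \<open>0 \<le> b \<bullet> z = (z v* A) \<bullet> x0\<close>. Positivity of \<open>x0\<close>
    forces \<open>z v* A = 0\<close>, so \<open>z = 0\<close>, although \<open>(z, m)\<close> has
    norm 1.\<close>
  have "m \<noteq> 0"
  proof
    assume "m = 0"
    then have le: "(z v* A) $ j \<le> 0" for j using zfeas[of j] by simp
    have "0 \<le> (z v* A) \<bullet> x0"
      using zval \<open>m = 0\<close> x0(1) by (simp add: dot_lmul_matrix inner_commute[of b])
    then have "0 \<le> (\<Sum>j\<in>UNIV. (z v* A) $ j * x0 $ j)"
      by (simp add: inner_vec_def)
    moreover have terms: "(z v* A) $ j * x0 $ j \<le> 0" for j
      using le[of j] x0(2)[of j] by (simp add: mult_nonpos_nonneg less_imp_le)
    ultimately have "(\<Sum>j\<in>UNIV. (z v* A) $ j * x0 $ j) = 0"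
      by (intro antisym sum_nonpos)
    then have "(\<Sum>j\<in>UNIV. - ((z v* A) $ j * x0 $ j)) = 0"
      by (simp add: sum_negf)
    then have "\<forall>j\<in>UNIV. - ((z v* A) $ j * x0 $ j) = 0"
      using terms by (subst (asm) sum_nonneg_eq_0_iff) auto
    then have "(z v* A) $ j = 0" for j
      using x0(2)[of j] by (metis UNIV_I less_irrefl mult_eq_0_iff neg_equal_0_iff_equal)
    then have "z v* A = 0"
      by (simp add: vec_eq_iff)
    then have "z = 0" by (rule row_independent_trivial_kernel[OF inj ind])
    with p \<open>m = 0\<close> show False by (simp add: zm)
  qed
  with \<open>0 \<le> m\<close> have "0 < m" by simp
  show thesis
  proof
    show "strict_mono r" by (rule r)
    show ev: "\<forall>\<^sub>F k in sequentially. 0 < l (r k)"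
      using order_tendstoD(1)[OF llim \<open>0 < m\<close>]
    proof eventually_elim
      case (elim k)
      with N[of "r k"] show ?case by (simp add: zero_less_divide_iff)
    qed
    have "(\<lambda>k. (y (r k) /\<^sub>R N (r k)) /\<^sub>R (l (r k) / N (r k))) \<longlonglongrightarrow> z /\<^sub>R m"
      using ylim llim \<open>0 < m\<close> by (intro tendsto_intros) auto
    moreover have "(y k /\<^sub>R N k) /\<^sub>R (l k / N k) = y k /\<^sub>R l k" for k
    proof -
      have "inverse (l k / N k) * inverse (N k) = inverse (l k)"
        using N[of k] by (simp add: divide_inverse)
      then show ?thesis by (simp only: scaleR_scaleR)
    qed
    ultimately show "(\<lambda>k. y (r k) /\<^sub>R l (r k)) \<longlonglongrightarrow> z /\<^sub>R m" by (simp only:)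
    show "(z /\<^sub>R m) v* A \<le> c"
    proof -
      have "(z v* A) $ j / m \<le> c $ j" for j
        using zfeas[of j] \<open>0 < m\<close> by (simp add: pos_divide_le_eq mult.commute)
      then show ?thesis
        unfolding scaleR_vector_matrix_assoc by (simp add: less_eq_vec_def divide_inverse_commute)
    qed
    show "v \<le> b \<bullet> (z /\<^sub>R m)"
    proof -
      have "v \<le> (b \<bullet> z) / m"
        using zval \<open>0 < m\<close> by (simp add: pos_le_divide_eq mult.commute)
      then show ?thesis by (simp add: divide_inverse_commute)
    qed
  qed
qed

section \<open>Optimal solution sets and first-order perturbation bounds\<close>

definition primal_opt :: "real ^ 'n ^ 'm \<Rightarrow> real ^ 'm \<Rightarrow> real ^ 'n \<Rightarrow> (real ^ 'n) set" where
  "primal_opt A b c = {x. A *v x = b \<and> 0 \<le> x \<and> lp_value A b c = ereal (c \<bullet> x)}"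

text \<open>Optimality means attaining the primal value, so that nonemptiness of this set is strong
  duality.\<close>

definition dual_opt :: "real ^ 'n ^ 'm \<Rightarrow> real ^ 'm \<Rightarrow> real ^ 'n \<Rightarrow> (real ^ 'm) set" where
  "dual_opt A b c = {y. y v* A \<le> c \<and> lp_value A b c = ereal (b \<bullet> y)}"

text \<open>The formula for \<open>d_w(B)\<close>, freed from the basis so that it can be evaluated
  at any pair of solutions.\<close>

definition sensitivity ::
    "real ^ 'n ^ 'm \<Rightarrow> real ^ 'm \<Rightarrow> real ^ 'n \<Rightarrow> real ^ 'n \<Rightarrow> real ^ 'm \<Rightarrow> real" where
  "sensitivity A\<Delta> b\<Delta> c\<Delta> x y = \<bar>y\<bar> \<bullet> (A\<Delta> *v x) + \<bar>y\<bar> \<bullet> b\<Delta> + x \<bullet> c\<Delta>"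

lemma tendsto_sensitivity:
  assumes "(f \<longlongrightarrow> y) F"
  shows "((\<lambda>k. sensitivity A\<Delta> b\<Delta> c\<Delta> x (f k)) \<longlongrightarrow> sensitivity A\<Delta> b\<Delta> c\<Delta> x y) F"
  unfolding sensitivity_def by (intro tendsto_intros tendsto_abs_vec assms)

text \<open>Active constraints do not increase along \<open>d\<close>; the others have slack, which
  survives short steps by continuity. There are finitely many constraints.\<close>

lemma eventually_feasible_ray:
  fixes A :: "real ^ 'n ^ 'm"
  assumes "y v* A \<le> c" and dir: "\<And>j. (y v* A) $ j = c $ j \<Longrightarrow> (d v* A) $ j \<le> 0"
  shows "\<forall>\<^sub>F e in at_right 0. (y + e *\<^sub>R d) v* A \<le> c"
proof -
  have "\<forall>\<^sub>F e in at_right 0. ((y + e *\<^sub>R d) v* A) $ j \<le> c $ j" for j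
  proof (cases "(y v* A) $ j = c $ j")
    case True
    show ?thesis
      using eventually_at_right_less[of "0 :: real"]
      by eventually_elim (use True dir[OF True] in \<open>simp add: vector_matrix_left_distrib scaleR_vector_matrix_assoc mult_nonneg_nonpos less_imp_le\<close>)
  next
    case False
    with assms(1) have "(y v* A) $ j < c $ j"
      by (auto simp: less_eq_vec_def order_less_le)
    moreover have "((\<lambda>e. ((y + e *\<^sub>R d) v* A) $ j) \<longlongrightarrow> ((y + 0 *\<^sub>R d) v* A) $ j) (at_right 0)"
      by (intro tendsto_vec_nth tendsto_vector_matrix_mult tendsto_intros)
    ultimately have "\<forall>\<^sub>F e in at_right 0. ((y + e *\<^sub>R d) v* A) $ j < c $ j"
      by (intro order_tendstoD(2)) auto
    then show ?thesis by eventually_elim simp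
  qed
  then show ?thesis
    unfolding less_eq_vec_def by (rule eventually_all_finite)
qed

text \<open>The duality gap is the sum of the products of dual slack and \<open>x $ j\<close>, all
  nonnegative, so it vanishes iff every product does.\<close>

lemma complementary_slackness:
  fixes A :: "real ^ 'n ^ 'm"
  assumes y: "y \<in> dual_opt A b c" and x: "A *v x = b" "0 \<le> x"
  shows "x \<in> primal_opt A b c \<longleftrightarrow> (\<forall>j. (y v* A) $ j \<noteq> c $ j \<longrightarrow> x $ j = 0)"
proof -
  have "c \<bullet> x - b \<bullet> y = (c - y v* A) \<bullet> x"
    using x(1) by (simp add: inner_diff_left dot_lmul_matrix inner_commute[of b])
  also have "\<dots> = (\<Sum>j\<in>UNIV. (c $ j - (y v* A) $ j) * x $ j)"
    by (simp add: inner_vec_def)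
  finally have eq: "c \<bullet> x - b \<bullet> y = (\<Sum>j\<in>UNIV. (c $ j - (y v* A) $ j) * x $ j)" .
  have "x \<in> primal_opt A b c \<longleftrightarrow> c \<bullet> x - b \<bullet> y = 0"
    using x y by (auto simp: primal_opt_def dual_opt_def)
  also have "\<dots> \<longleftrightarrow> (\<forall>j\<in>UNIV. (c $ j - (y v* A) $ j) * x $ j = 0)"
    unfolding eq using x y
    by (intro sum_nonneg_eq_0_iff) (auto simp: dual_opt_def less_eq_vec_def)
  finally show ?thesis
    by (metis (no_types, lifting) UNIV_I eq_iff_diff_eq_0 mult_eq_0_iff)
qed

text \<open>The signs of \<open>y\<close> select the corner of the box most favourable to
  \<open>y\<close>: there \<open>y\<close> is dual feasible and its objective is the left-hand side,
  so weak duality applies.\<close>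

lemma worst_value_ge:
  fixes A :: "real ^ 'n ^ 'm"
  assumes nonneg: "0 \<le> A\<Delta>" "0 \<le> b\<Delta>" "0 \<le> c\<Delta>" "0 \<le> \<alpha>"
    and feas: "y v* A \<le> c + \<alpha> *\<^sub>R (c\<Delta> + \<bar>y\<bar> v* A\<Delta>)"
  shows "ereal (b \<bullet> y + \<alpha> * (\<bar>y\<bar> \<bullet> b\<Delta>)) \<le> worst_value A b c A\<Delta> b\<Delta> c\<Delta> \<alpha>"
proof -
  define A' where "A' = (\<chi> i j. A $ i $ j - \<alpha> * sgn (y $ i) * A\<Delta> $ i $ j)"
  define b' where "b' = (\<chi> i. b $ i + \<alpha> * sgn (y $ i) * b\<Delta> $ i)"
  have sgn_bound: "- (\<alpha> * d) \<le> \<alpha> * sgn (t :: real) * d \<and> \<alpha> * sgn t * d \<le> \<alpha> * d" if "0 \<le> d" for d t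
    using that nonneg(4) by (auto simp: sgn_if)
  have A': "A' \<in> {A - \<alpha> *\<^sub>R A\<Delta> .. A + \<alpha> *\<^sub>R A\<Delta>}"
    using nonneg(1) sgn_bound by (auto simp: A'_def less_eq_vec_def) (smt (verit))+
  have b': "b' \<in> {b - \<alpha> *\<^sub>R b\<Delta> .. b + \<alpha> *\<^sub>R b\<Delta>}"
    using nonneg(2) sgn_bound by (auto simp: b'_def less_eq_vec_def)
  have c': "c + \<alpha> *\<^sub>R c\<Delta> \<in> {c - \<alpha> *\<^sub>R c\<Delta> .. c + \<alpha> *\<^sub>R c\<Delta>}"
    using nonneg(3,4) by (auto simp: less_eq_vec_def)
  have "(y v* A') $ j = (y v* A) $ j - \<alpha> * (\<bar>y\<bar> v* A\<Delta>) $ j" for j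
    by (simp add: vector_matrix_mult_def A'_def abs_vec_nth abs_sgn sum_distrib_left
        algebra_simps flip: sum_subtractf)
  then have "y v* A' \<le> c + \<alpha> *\<^sub>R c\<Delta>"
    using feas by (simp add: less_eq_vec_def distrib_left diff_le_eq add.assoc)
  from weak_duality[OF this] have "ereal (b' \<bullet> y) \<le> lp_value A' b' (c + \<alpha> *\<^sub>R c\<Delta>)" .
  also have "\<dots> \<le> worst_value A b c A\<Delta> b\<Delta> c\<Delta> \<alpha>"
    unfolding worst_value_def using A' b' c' by (intro Sup_upper) blast
  also have "b' \<bullet> y = b \<bullet> y + \<alpha> * (\<bar>y\<bar> \<bullet> b\<Delta>)"
    by (simp add: inner_vec_def b'_def abs_vec_nth abs_sgn sum_distrib_left
        algebra_simps flip: sum.distrib)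
  finally show ?thesis .
qed

text \<open>Weak duality of a perturbed dual point against an unperturbed primal point: all box
  errors, paired with \<open>x\<close>, add up to the sensitivity.\<close>

lemma perturbed_dual_value_le:
  fixes A :: "real ^ 'n ^ 'm"
  assumes A': "A' \<in> {A - \<alpha> *\<^sub>R A\<Delta> .. A + \<alpha> *\<^sub>R A\<Delta>}"
    and b': "b' \<in> {b - \<alpha> *\<^sub>R b\<Delta> .. b + \<alpha> *\<^sub>R b\<Delta>}"
    and c': "c' \<in> {c - \<alpha> *\<^sub>R c\<Delta> .. c + \<alpha> *\<^sub>R c\<Delta>}"
    and y: "y v* A' \<le> c'" and x: "A *v x = b" "0 \<le> x"
  shows "b' \<bullet> y \<le> c \<bullet> x + \<alpha> * sensitivity A\<Delta> b\<Delta> c\<Delta> x y"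
proof -
  have "b' \<bullet> y \<le> b \<bullet> y + \<alpha> * (\<bar>y\<bar> \<bullet> b\<Delta>)"
    using inner_abs_perturb[of b "\<alpha> *\<^sub>R b\<Delta>" b' y] b' by (simp add: inner_commute)
  moreover have "b \<bullet> y = (y v* A) \<bullet> x"
    using x(1) by (simp add: dot_lmul_matrix inner_commute[of b])
  \<comment> \<open>Replacing \<open>A'\<close> and \<open>c'\<close> by the nominal data keeps
    \<open>y\<close> feasible for a relaxed dual, checked column by column.\<close>
  moreover have "y v* A \<le> c + \<alpha> *\<^sub>R (c\<Delta> + \<bar>y\<bar> v* A\<Delta>)"
    unfolding less_eq_vec_def
  proof
    fix j
    have col: "(z v* M) $ j = column j M \<bullet> z" for z :: "real ^ 'm" and M :: "real ^ 'n ^ 'm"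
      by (simp add: vector_matrix_mult_column inner_commute)
    have "column j A \<bullet> y \<le> column j A' \<bullet> y + (\<alpha> *\<^sub>R column j A\<Delta>) \<bullet> \<bar>y\<bar>"
      using A' by (intro inner_abs_perturb) (auto simp: less_eq_vec_def column_def algebra_simps)
    moreover have "column j A' \<bullet> y \<le> (c + \<alpha> *\<^sub>R c\<Delta>) $ j"
      using y c' by (auto simp: less_eq_vec_def col[symmetric] intro: order_trans)
    ultimately show "(y v* A) $ j \<le> (c + \<alpha> *\<^sub>R (c\<Delta> + \<bar>y\<bar> v* A\<Delta>)) $ j"
      by (simp add: col algebra_simps)
  qed
  then have "(y v* A) \<bullet> x \<le> (c + \<alpha> *\<^sub>R (c\<Delta> + \<bar>y\<bar> v* A\<Delta>)) \<bullet> x"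
    using x(2) by (rule inner_mono_nonneg)
  ultimately show ?thesis
    by (simp add: sensitivity_def inner_add_left dot_lmul_matrix inner_commute[of c\<Delta>] algebra_simps)
qed

section \<open>The rate of change of the worst case value\<close>

text \<open>The regularity assumptions in terms of witnesses. Strictness of \<open>y0\<close> is
  restricted to nonzero columns, because a zero column imposes a constraint independent of
  \<open>y\<close> that may be tight.\<close>

locale regular_lp =
  fixes A :: "real ^ 'n ^ 'm" and b :: "real ^ 'm" and c :: "real ^ 'n"
    and x0 :: "real ^ 'n" and y0 :: "real ^ 'm"
  assumes inj_rows: "inj (\<lambda>i. row i A)"
    and independent_rows: "independent (range (\<lambda>i. row i A))"
    and x0: "A *v x0 = b" and x0_pos: "\<And>j. 0 < x0 $ j"
    and y0: "y0 v* A \<le> c" and y0_strict: "\<And>j. column j A \<noteq> 0 \<Longrightarrow> (y0 v* A) $ j < c $ j"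
begin

lemma finite_value: obtains f where "lp_value A b c = ereal f"
proof -
  have "lp_value A b c \<le> ereal (c \<bullet> x0)"
    using x0 x0_pos by (intro lp_value_le) (auto simp: less_eq_vec_def less_imp_le)
  moreover have "ereal (b \<bullet> y0) \<le> lp_value A b c"
    by (rule weak_duality[OF y0])
  ultimately show thesis
    using that by (cases "lp_value A b c") auto
qed

lemma dual_optI:
  assumes "lp_value A b c = ereal f" and "y v* A \<le> c" and "f \<le> b \<bullet> y"
  shows "y \<in> dual_opt A b c"
  using weak_duality[OF assms(2), of b] assms by (simp add: dual_opt_def)

text \<open>Strong duality: homogenised certificates for values increasing to the optimum accumulate
  at a dual optimal point, by \<open>dual_limit\<close> with constant data.\<close>

lemma dual_opt_nonempty: "dual_opt A b c \<noteq> {}"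
proof -
  obtain f where f: "lp_value A b c = ereal f" by (rule finite_value)
  define v where "v = (\<lambda>k. f - 1 / real (Suc k))"
  have "\<forall>k. \<exists>y l. 0 \<le> l \<and> y v* A \<le> l *\<^sub>R c \<and> l * v k < b \<bullet> y"
  proof
    fix k
    have "ereal (v k) < lp_value A b c" by (simp add: f v_def)
    then show "\<exists>y l. 0 \<le> l \<and> y v* A \<le> l *\<^sub>R c \<and> l * v k < b \<bullet> y"
      by (rule below_lp_value) blast
  qed
  then obtain y l where yl: "\<And>k. 0 \<le> l k" "\<And>k. y k v* A \<le> l k *\<^sub>R c" "\<And>k. l k * v k < b \<bullet> y k"
    by metis
  have nz: "(y k, l k) \<noteq> 0" for k
    using yl(3)[of k] by (auto simp: zero_prod_def)
  have "v \<longlonglongrightarrow> f - 0"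
    unfolding v_def by (intro tendsto_diff tendsto_const LIMSEQ_Suc[OF lim_1_over_n])
  then have vlim: "v \<longlonglongrightarrow> f" by simp
  obtain r :: "nat \<Rightarrow> nat" and z where "z v* A \<le> c" "f \<le> b \<bullet> z"
    by (rule dual_limit[OF inj_rows independent_rows x0 x0_pos tendsto_const tendsto_const tendsto_const
          vlim nz yl(1,2) less_imp_le[OF yl(3)]])
  then show ?thesis using dual_optI[OF f] by blast
qed

text \<open>The case of constant data and \<open>l = 1\<close> in \<open>dual_limit\<close>.\<close>

lemma compact_dual_opt: "compact (dual_opt A b c)"
  unfolding compact_eq_seq_compact_metric
proof (rule seq_compactI)
  fix y assume y: "\<forall>k :: nat. y k \<in> dual_opt A b c"
  obtain f where f: "lp_value A b c = ereal f" by (rule finite_value)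
  have feas: "y k v* A \<le> (1 :: real) *\<^sub>R c" and val: "1 * f \<le> b \<bullet> y k" for k
    using y f by (auto simp: dual_opt_def)
  have nz: "(y k, 1 :: real) \<noteq> 0" for k
    by (simp add: zero_prod_def)
  obtain r z where r: "strict_mono r" "(\<lambda>k. y (r k) /\<^sub>R 1) \<longlonglongrightarrow> z" "z v* A \<le> c" "f \<le> b \<bullet> z"
    by (rule dual_limit[OF inj_rows independent_rows x0 x0_pos tendsto_const tendsto_const tendsto_const
          tendsto_const nz zero_le_one feas val])
  then show "\<exists>z\<in>dual_opt A b c. \<exists>r. strict_mono r \<and> (y \<circ> r) \<longlonglongrightarrow> z"
    using dual_optI[OF f] by (auto simp: o_def)
qed

text \<open>Otherwise no feasible point satisfies complementary slackness with a dual optimal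
  \<open>y\<close>, and the alternative provides a feasible direction at \<open>y\<close> that
  improves the dual objective.\<close>

lemma primal_opt_nonempty: "primal_opt A b c \<noteq> {}"
proof
  assume empty: "primal_opt A b c = {}"
  obtain y where y: "y \<in> dual_opt A b c" using dual_opt_nonempty by blast
  define T where "T = {j. (y v* A) $ j = c $ j}"
  \<comment> \<open>With zero cost and \<open>v = 0\<close> the strict inequality is absurd, so it
    expresses that no such \<open>x\<close> exists.\<close>
  have "(0 :: real) < 0 \<bullet> x" if "A *v x = b" "0 \<le> x" "\<forall>j. j \<notin> T \<longrightarrow> x $ j = 0" for x
    using complementary_slackness[OF y that(1,2)] that(3) empty by (auto simp: T_def)
  then obtain d l where d: "\<forall>j\<in>T. (d v* A) $ j \<le> l * (0 :: real ^ 'n) $ j" "l * 0 < b \<bullet> d"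
    using lp_alternative[of A b T 0 0] by blast
  have "y v* A \<le> c" using y by (simp add: dual_opt_def)
  then have "\<forall>\<^sub>F e in at_right 0. (y + e *\<^sub>R d) v* A \<le> c"
    using d(1) by (intro eventually_feasible_ray) (auto simp: T_def)
  then have "\<forall>\<^sub>F e in at_right (0 :: real). 0 < e \<and> (y + e *\<^sub>R d) v* A \<le> c"
    using eventually_at_right_less by (rule eventually_conj[rotated])
  then obtain e where e: "0 < e" "(y + e *\<^sub>R d) v* A \<le> c"
    using eventually_happens'[OF trivial_limit_at_right_real] by blast
  have "ereal (b \<bullet> (y + e *\<^sub>R d)) \<le> ereal (b \<bullet> y)"
    using weak_duality[OF e(2), of b] y by (simp add: dual_opt_def)
  then have "e * (b \<bullet> d) \<le> 0" by (simp add: inner_add_right)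
  with e(1) d(2) show False by (simp add: mult_le_0_iff)
qed

text \<open>Here \<open>M\<close> bounds the max-min of the sensitivity. If the claim failed along a
  sequence of \<open>\<alpha>\<close> tending to 0, the dual certificates would accumulate at a dual
  optimal point whose sensitivity is at least \<open>M + e\<close> for every optimal
  \<open>x\<close>.\<close>

lemma eventually_worst_value_le:
  assumes f: "lp_value A b c = ereal f" and "0 < e"
    and M: "\<And>r y. y \<in> dual_opt A b c \<Longrightarrow>
      \<forall>x\<in>primal_opt A b c. r \<le> sensitivity A\<Delta> b\<Delta> c\<Delta> x y \<Longrightarrow> r \<le> M"
  shows "\<forall>\<^sub>F \<alpha> in at_right 0. worst_value A b c A\<Delta> b\<Delta> c\<Delta> \<alpha> \<le> ereal (f + \<alpha> * (M + e))"
proof (rule ccontr)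
  assume not: "\<not> ?thesis"
  have "\<exists>\<alpha> A' b' c' y l. 0 < \<alpha> \<and> \<alpha> < 1 / real (Suc k)
      \<and> A' \<in> {A - \<alpha> *\<^sub>R A\<Delta> .. A + \<alpha> *\<^sub>R A\<Delta>}
      \<and> b' \<in> {b - \<alpha> *\<^sub>R b\<Delta> .. b + \<alpha> *\<^sub>R b\<Delta>}
      \<and> c' \<in> {c - \<alpha> *\<^sub>R c\<Delta> .. c + \<alpha> *\<^sub>R c\<Delta>}
      \<and> 0 \<le> l \<and> y v* A' \<le> l *\<^sub>R c' \<and> l * (f + \<alpha> * (M + e)) < b' \<bullet> y" for k
  proof -
    have "\<not> (\<exists>d>0. \<forall>\<alpha>>0. \<alpha> < d \<longrightarrow> worst_value A b c A\<Delta> b\<Delta> c\<Delta> \<alpha> \<le> ereal (f + \<alpha> * (M + e)))"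
      using not unfolding eventually_at_right_field .
    moreover have "0 < 1 / real (Suc k)" by simp
    ultimately obtain \<alpha> where \<alpha>: "0 < \<alpha>" "\<alpha> < 1 / real (Suc k)"
      "ereal (f + \<alpha> * (M + e)) < worst_value A b c A\<Delta> b\<Delta> c\<Delta> \<alpha>"
      by (metis not_le)
    then obtain A' b' c' where box: "A' \<in> {A - \<alpha> *\<^sub>R A\<Delta> .. A + \<alpha> *\<^sub>R A\<Delta>}"
        "b' \<in> {b - \<alpha> *\<^sub>R b\<Delta> .. b + \<alpha> *\<^sub>R b\<Delta>}" "c' \<in> {c - \<alpha> *\<^sub>R c\<Delta> .. c + \<alpha> *\<^sub>R c\<Delta>}"
        and "ereal (f + \<alpha> * (M + e)) < lp_value A' b' c'"
      unfolding worst_value_def less_Sup_iff by blast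
    from this(4) obtain y l where "0 \<le> l" "y v* A' \<le> l *\<^sub>R c'" "l * (f + \<alpha> * (M + e)) < b' \<bullet> y"
      by (rule below_lp_value)
    with \<alpha>(1,2) box show ?thesis by blast
  qed
  then obtain \<alpha> A' b' c' y l where \<alpha>: "\<And>k. 0 < \<alpha> k" "\<And>k. \<alpha> k < 1 / real (Suc k)"
    and A': "\<And>k. A' k \<in> {A - \<alpha> k *\<^sub>R A\<Delta> .. A + \<alpha> k *\<^sub>R A\<Delta>}"
    and b': "\<And>k. b' k \<in> {b - \<alpha> k *\<^sub>R b\<Delta> .. b + \<alpha> k *\<^sub>R b\<Delta>}"
    and c': "\<And>k. c' k \<in> {c - \<alpha> k *\<^sub>R c\<Delta> .. c + \<alpha> k *\<^sub>R c\<Delta>}"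
    and yl: "\<And>k. 0 \<le> l k" "\<And>k. y k v* A' k \<le> l k *\<^sub>R c' k"
      "\<And>k. l k * (f + \<alpha> k * (M + e)) < b' k \<bullet> y k"
    by metis
  have \<alpha>_lim: "\<alpha> \<longlonglongrightarrow> 0"
  proof (rule tendsto_sandwich[where f = "\<lambda>_. 0" and h = "\<lambda>k. 1 / real (Suc k)"])
    show "(\<lambda>k. 1 / real (Suc k)) \<longlonglongrightarrow> 0" by (rule LIMSEQ_Suc[OF lim_1_over_n])
  qed (use \<alpha> in \<open>auto simp: less_imp_le\<close>)
  \<comment> \<open>The perturbed data converge entrywise, squeezed by the shrinking box.\<close>
  have lim_box: "h \<longlonglongrightarrow> u" if "\<And>k. u - \<alpha> k * d \<le> h k" "\<And>k. h k \<le> u + \<alpha> k * d" for h and u d :: real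
  proof (rule tendsto_sandwich)
    have "(\<lambda>k. u - \<alpha> k * d) \<longlonglongrightarrow> u - 0 * d" "(\<lambda>k. u + \<alpha> k * d) \<longlonglongrightarrow> u + 0 * d"
      by (intro tendsto_intros \<alpha>_lim)+
    then show "(\<lambda>k. u - \<alpha> k * d) \<longlonglongrightarrow> u" "(\<lambda>k. u + \<alpha> k * d) \<longlonglongrightarrow> u" by simp_all
  qed (use that in auto)
  have "(\<lambda>k. A' k $ i $ j) \<longlonglongrightarrow> A $ i $ j" for i j
    using A' by (intro lim_box[where d = "A\<Delta> $ i $ j"]) (auto simp: less_eq_vec_def)
  moreover have "(\<lambda>k. b' k $ i) \<longlonglongrightarrow> b $ i" for i
    using b' by (intro lim_box[where d = "b\<Delta> $ i"]) (auto simp: less_eq_vec_def)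
  moreover have "(\<lambda>k. c' k $ j) \<longlonglongrightarrow> c $ j" for j
    using c' by (intro lim_box[where d = "c\<Delta> $ j"]) (auto simp: less_eq_vec_def)
  ultimately have lims: "A' \<longlonglongrightarrow> A" "b' \<longlonglongrightarrow> b" "c' \<longlonglongrightarrow> c"
    by (auto intro!: vec_tendstoI)
  \<comment> \<open>The target values tend to \<open>f\<close>, so the limit of the certificates
    will be dual optimal.\<close>
  have "(\<lambda>k. f + \<alpha> k * (M + e)) \<longlonglongrightarrow> f + 0 * (M + e)"
    by (intro tendsto_intros \<alpha>_lim)
  then have vlim: "(\<lambda>k. f + \<alpha> k * (M + e)) \<longlonglongrightarrow> f" by simp
  have nz: "(y k, l k) \<noteq> 0" for k
    using yl(3)[of k] by (auto simp: zero_prod_def)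
  obtain r z where r: "strict_mono r" "\<forall>\<^sub>F k in sequentially. 0 < l (r k)"
      and lim: "(\<lambda>k. y (r k) /\<^sub>R l (r k)) \<longlonglongrightarrow> z" and z: "z v* A \<le> c" "f \<le> b \<bullet> z"
    by (rule dual_limit[OF inj_rows independent_rows x0 x0_pos lims vlim nz yl(1,2) less_imp_le[OF yl(3)]])
  have "z \<in> dual_opt A b c" by (rule dual_optI[OF f z])
  moreover have "\<forall>x\<in>primal_opt A b c. M + e \<le> sensitivity A\<Delta> b\<Delta> c\<Delta> x z"
  proof
    fix x assume x: "x \<in> primal_opt A b c"
    have "\<forall>\<^sub>F k in sequentially. M + e \<le> sensitivity A\<Delta> b\<Delta> c\<Delta> x (y (r k) /\<^sub>R l (r k))"
      using r(2)
    proof eventually_elim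
      case (elim k)
      define q where "q = r k"
      have "0 < l q" using elim by (simp add: q_def)
      have "(y q v* A' q) $ j / l q \<le> c' q $ j" for j
        using yl(2)[of q] \<open>0 < l q\<close> by (simp add: less_eq_vec_def pos_divide_le_eq mult.commute)
      then have "(y q /\<^sub>R l q) v* A' q \<le> c' q"
        unfolding scaleR_vector_matrix_assoc by (simp add: less_eq_vec_def divide_inverse_commute)
      from perturbed_dual_value_le[OF A' b' c' this, of x]
      have "b' q \<bullet> (y q /\<^sub>R l q) \<le> f + \<alpha> q * sensitivity A\<Delta> b\<Delta> c\<Delta> x (y q /\<^sub>R l q)"
        using x f by (simp add: primal_opt_def)
      moreover have "f + \<alpha> q * (M + e) < (b' q \<bullet> y q) / l q"
        using yl(3)[of q] \<open>0 < l q\<close> by (simp add: pos_less_divide_eq mult.commute)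
      \<comment> \<open>The common value \<open>f\<close> cancels, and dividing by the positive
        \<open>\<alpha> q\<close> leaves a first-order inequality.\<close>
      ultimately have "\<alpha> q * (M + e) < \<alpha> q * sensitivity A\<Delta> b\<Delta> c\<Delta> x (y q /\<^sub>R l q)"
        by (simp add: divide_inverse_commute)
      then show ?case
        using \<alpha>(1)[of q] by (simp add: q_def less_imp_le)
    qed
    with tendsto_sensitivity[OF lim] show "M + e \<le> sensitivity A\<Delta> b\<Delta> c\<Delta> x z"
      by (intro tendsto_lowerbound) auto
  qed
  ultimately have "M + e \<le> M" by (rule M)
  with \<open>0 < e\<close> show False by simp
qed

text \<open>
  Dual feasible points are sought on a ray leaving \<open>y\<close>, whose direction is feasible for the dual of
  minimising the sensitivity over \<open>primal_opt A b c\<close>. Tilting it towards \<open>y0\<close> makes the active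
  constraints strict, except for zero columns of \<open>A\<close>, whose constraints cannot be violated. Because of
  such columns \<open>primal_opt A b c\<close> may be unbounded, so compactness is only available on the dual side.
\<close>

lemma eventually_worst_value_ge:
  assumes nonneg: "0 \<le> A\<Delta>" "0 \<le> b\<Delta>" "0 \<le> c\<Delta>"
    and f: "lp_value A b c = ereal f" and "0 < e" and y: "y \<in> dual_opt A b c"
    and r: "\<And>x. x \<in> primal_opt A b c \<Longrightarrow> r \<le> sensitivity A\<Delta> b\<Delta> c\<Delta> x y"
  shows "\<forall>\<^sub>F \<alpha> in at_right 0. ereal (f + \<alpha> * (r - e)) \<le> worst_value A b c A\<Delta> b\<Delta> c\<Delta> \<alpha>"
proof -
  define g where "g = c\<Delta> + \<bar>y\<bar> v* A\<Delta>"
  define T where "T = {j. (y v* A) $ j = c $ j}"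
  \<comment> \<open>The \<open>b\<Delta>\<close> term does not depend on \<open>x\<close> and is
    split off; subtracting \<open>e\<close> gives the strict inequality required by
    \<open>lp_alternative\<close>.\<close>
  define v where "v = r - e - \<bar>y\<bar> \<bullet> b\<Delta>"
  have yfeas: "y v* A \<le> c" and yval: "b \<bullet> y = f"
    using y f by (auto simp: dual_opt_def)
  have "v < g \<bullet> x" if "A *v x = b" "0 \<le> x" "\<forall>j. j \<notin> T \<longrightarrow> x $ j = 0" for x
  proof -
    have "x \<in> primal_opt A b c"
      using complementary_slackness[OF y that(1,2)] that(3) by (simp add: T_def)
    from r[OF this] have "r \<le> g \<bullet> x + \<bar>y\<bar> \<bullet> b\<Delta>"
      by (simp add: sensitivity_def g_def inner_add_left dot_lmul_matrix inner_commute[of c\<Delta>])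
    with \<open>0 < e\<close> show ?thesis by (simp add: v_def)
  qed
  then obtain d l where l: "0 \<le> l" and d: "\<forall>j\<in>T. (d v* A) $ j \<le> l * g $ j" "l * v < b \<bullet> d"
    using lp_alternative[of A b T v g] by blast
  obtain x where x: "x \<in> primal_opt A b c" using primal_opt_nonempty by blast
  \<comment> \<open>For \<open>l = 0\<close>, pairing \<open>d\<close> with an optimal
    \<open>x\<close>, which is supported on \<open>T\<close>, would give
    \<open>b \<bullet> d \<le> 0\<close>.\<close>
  have "l \<noteq> 0"
  proof
    assume "l = 0"
    have xT: "x $ j = 0" if "j \<notin> T" for j
      using complementary_slackness[OF y, of x] x that by (auto simp: primal_opt_def T_def)
    have xnn: "0 \<le> x $ j" for j
      using x by (simp add: primal_opt_def less_eq_vec_def)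
    have "b \<bullet> d = (d v* A) \<bullet> x"
      using x by (auto simp: primal_opt_def dot_lmul_matrix inner_commute[of _ d])
    also have "\<dots> = (\<Sum>j\<in>UNIV. (d v* A) $ j * x $ j)"
      by (simp add: inner_vec_def)
    also have "\<dots> \<le> 0"
    proof (rule sum_nonpos)
      fix j
      show "(d v* A) $ j * x $ j \<le> 0"
        using d(1) xT[of j] xnn[of j] \<open>l = 0\<close> by (cases "j \<in> T") (auto simp: mult_nonpos_nonneg)
    qed
    finally show False using d(2) \<open>l = 0\<close> by simp
  qed
  with l have "0 < l" by simp
  define u where "u = y0 - y"
  have "((\<lambda>s. b \<bullet> (d /\<^sub>R l + s *\<^sub>R u)) \<longlongrightarrow> b \<bullet> (d /\<^sub>R l + 0 *\<^sub>R u)) (at_right 0)"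
    by (intro tendsto_intros)
  moreover have "v < b \<bullet> (d /\<^sub>R l + 0 *\<^sub>R u)"
  proof -
    have "v < (b \<bullet> d) / l"
      using d(2) \<open>0 < l\<close> by (simp add: pos_less_divide_eq mult.commute)
    then show ?thesis by (simp add: divide_inverse_commute)
  qed
  ultimately have "\<forall>\<^sub>F s in at_right 0. v < b \<bullet> (d /\<^sub>R l + s *\<^sub>R u)"
    by (rule order_tendstoD(1))
  then have "\<forall>\<^sub>F s in at_right (0 :: real). 0 < s \<and> v < b \<bullet> (d /\<^sub>R l + s *\<^sub>R u)"
    using eventually_at_right_less by (rule eventually_conj[rotated])
  then obtain s where s: "0 < s" "v < b \<bullet> (d /\<^sub>R l + s *\<^sub>R u)"
    using eventually_happens'[OF trivial_limit_at_right_real] by blast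
  define z where "z = d /\<^sub>R l + s *\<^sub>R u"
  have zT: "(z v* A) $ j < g $ j" if "j \<in> T" "column j A \<noteq> 0" for j
  proof -
    have "(d v* A) $ j / l \<le> g $ j"
      using d(1) that(1) \<open>0 < l\<close> by (simp add: pos_divide_le_eq mult.commute)
    moreover have "(u v* A) $ j = (y0 v* A) $ j - (y v* A) $ j"
      by (simp add: u_def vector_matrix_mult_def algebra_simps sum_subtractf)
    then have "(u v* A) $ j < 0"
      using y0_strict[OF that(2)] that(1) by (simp add: T_def)
    then have "s * (u v* A) $ j < 0" using s(1) by (simp add: mult_pos_neg)
    ultimately show ?thesis
      by (simp add: z_def vector_matrix_left_distrib scaleR_vector_matrix_assoc divide_inverse_commute)
  qed
  define ya where "ya = (\<lambda>\<alpha>. y + \<alpha> *\<^sub>R z)"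
  have ya_lim: "(ya \<longlongrightarrow> y) (at_right 0)"
  proof -
    have "((\<lambda>\<alpha>. y + \<alpha> *\<^sub>R z) \<longlongrightarrow> y + 0 *\<^sub>R z) (at_right 0)" by (intro tendsto_intros)
    then show ?thesis by (simp add: ya_def)
  qed
  \<comment> \<open>The relaxation must use the moving point \<open>ya \<alpha>\<close> rather than
    \<open>y\<close>. It tends to \<open>g\<close>, so strict inequalities persist for small
    \<open>\<alpha>\<close>.\<close>
  define ga where "ga = (\<lambda>\<alpha>. c\<Delta> + \<bar>ya \<alpha>\<bar> v* A\<Delta>)"
  have ga_lim: "(ga \<longlongrightarrow> g) (at_right 0)"
    unfolding ga_def g_def
    by (intro tendsto_intros tendsto_vector_matrix_mult tendsto_abs_vec ya_lim)
  have ga_nonneg: "0 \<le> ga \<alpha> $ j" for \<alpha> j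
  proof -
    have "0 \<le> c\<Delta> $ j" "0 \<le> (\<bar>ya \<alpha>\<bar> v* A\<Delta>) $ j"
      using nonneg(3) vector_mult_nonneg[OF nonneg(1) abs_vec_nonneg[of "ya \<alpha>"]]
      by (auto simp: less_eq_vec_def)
    then show ?thesis by (simp add: ga_def)
  qed
  have pos: "\<forall>\<^sub>F \<alpha> in at_right (0 :: real). 0 < \<alpha>" by (rule eventually_at_right_less)
  have "\<forall>\<^sub>F \<alpha> in at_right 0. (ya \<alpha> v* A) $ j \<le> (c + \<alpha> *\<^sub>R ga \<alpha>) $ j" for j
  proof -
    \<comment> \<open>A zero column only needs nonnegativity of the right-hand side; an active
      constraint uses the strict inequality for \<open>z\<close>; an inactive one has slack.\<close>
    consider "column j A = 0" | "j \<in> T" "column j A \<noteq> 0" | "j \<notin> T" by blast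
    then show ?thesis
    proof cases
      case 1
      have zero: "(w v* A) $ j = 0" for w
        using 1 by (simp add: vector_matrix_mult_def column_def vec_eq_iff)
      have cj: "0 \<le> c $ j" using yfeas zero[of y] by (metis less_eq_vec_def)
      show ?thesis
        using pos by eventually_elim (simp add: zero ga_nonneg cj)
    next
      case 2
      have "((\<lambda>\<alpha>. ga \<alpha> $ j) \<longlongrightarrow> g $ j) (at_right 0)"
        by (intro tendsto_vec_nth ga_lim)
      from order_tendstoD(1)[OF this zT[OF 2]] pos show ?thesis
      proof eventually_elim
        case (elim \<alpha>)
        then have "\<alpha> * (z v* A) $ j \<le> \<alpha> * ga \<alpha> $ j" by simp
        with 2(1) show ?case
          by (simp add: ya_def T_def vector_matrix_left_distrib scaleR_vector_matrix_assoc)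
      qed
    next
      case 3
      with yfeas have "(y v* A) $ j < c $ j"
        by (auto simp: T_def less_eq_vec_def order_less_le)
      moreover have "((\<lambda>\<alpha>. (ya \<alpha> v* A) $ j) \<longlongrightarrow> (y v* A) $ j) (at_right 0)"
        by (intro tendsto_vec_nth tendsto_vector_matrix_mult ya_lim tendsto_const)
      ultimately have "\<forall>\<^sub>F \<alpha> in at_right 0. (ya \<alpha> v* A) $ j < c $ j"
        by (rule order_tendstoD(2)[rotated])
      with pos show ?thesis
      proof eventually_elim
        case (elim \<alpha>)
        then have "0 \<le> \<alpha> * ga \<alpha> $ j" using ga_nonneg by simp
        with elim show ?case by simp
      qed
    qed
  qed
  then have feas: "\<forall>\<^sub>F \<alpha> in at_right 0. ya \<alpha> v* A \<le> c + \<alpha> *\<^sub>R ga \<alpha>"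
    unfolding less_eq_vec_def by (rule eventually_all_finite)
  have "((\<lambda>\<alpha>. b \<bullet> z + \<bar>ya \<alpha>\<bar> \<bullet> b\<Delta>) \<longlongrightarrow> b \<bullet> z + \<bar>y\<bar> \<bullet> b\<Delta>) (at_right 0)"
    by (intro tendsto_intros tendsto_abs_vec ya_lim)
  moreover have "r - e < b \<bullet> z + \<bar>y\<bar> \<bullet> b\<Delta>"
    using s(2) by (simp add: z_def v_def)
  ultimately have "\<forall>\<^sub>F \<alpha> in at_right 0. r - e < b \<bullet> z + \<bar>ya \<alpha>\<bar> \<bullet> b\<Delta>"
    by (rule order_tendstoD(1))
  with pos feas show ?thesis
  proof eventually_elim
    case (elim \<alpha>)
    then have "\<alpha> * (r - e) \<le> \<alpha> * (b \<bullet> z + \<bar>ya \<alpha>\<bar> \<bullet> b\<Delta>)" by simp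
    then have "f + \<alpha> * (r - e) \<le> b \<bullet> ya \<alpha> + \<alpha> * (\<bar>ya \<alpha>\<bar> \<bullet> b\<Delta>)"
      by (simp add: ya_def inner_add_right yval distrib_left)
    moreover have "ereal (b \<bullet> ya \<alpha> + \<alpha> * (\<bar>ya \<alpha>\<bar> \<bullet> b\<Delta>)) \<le> worst_value A b c A\<Delta> b\<Delta> c\<Delta> \<alpha>"
      using elim(1,2) by (intro worst_value_ge nonneg) (simp_all add: ga_def)
    ultimately show ?case by (meson ereal_less_eq(3) order_trans)
  qed
qed

end

section \<open>Vertices and optimal bases\<close>

lemma bij_betw_enum_of:
  fixes B :: "'n::finite set"
  assumes "card B = CARD('m::finite)"
  shows "bij_betw (enum_of B :: 'm \<Rightarrow> 'n) UNIV B"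
proof -
  have "\<exists>\<sigma> :: 'm \<Rightarrow> 'n. bij_betw \<sigma> UNIV B"
    using assms by (intro finite_same_card_bij) auto
  then show ?thesis unfolding enum_of_def by (rule someI_ex)
qed

text \<open>
  A basis is chosen between the support of \<open>x\<close>, whose columns are independent, and the set of
  dual constraints active at \<open>y\<close>, whose columns span.
\<close>

lemma common_optimal_basis:
  fixes A :: "real ^ 'n ^ 'm"
  assumes x: "x \<in> primal_opt A b c" and y: "y \<in> dual_opt A b c"
    and xker: "\<And>u. A *v u = 0 \<Longrightarrow> (\<And>j. x $ j = 0 \<Longrightarrow> u $ j = 0) \<Longrightarrow> u = 0"
    and yker: "\<And>d. (\<And>j. (y v* A) $ j = c $ j \<Longrightarrow> (d v* A) $ j = 0) \<Longrightarrow> d = 0"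
  obtains B where "optimal_basis A b c B" and "primal_sol A b B = x" and "dual_sol A c B = y"
proof -
  define col where "col = (\<lambda>j. column j A)"
  define S where "S = {j. x $ j \<noteq> 0}"
  define T where "T = {j. (y v* A) $ j = c $ j}"
  have Ax: "A *v x = b" "0 \<le> x" using x by (auto simp: primal_opt_def)
  have ST: "S \<subseteq> T"
    using complementary_slackness[OF y Ax] x by (auto simp: S_def T_def)
  have injS: "inj_on col S"
  proof (rule inj_onI, rule ccontr)
    fix i j assume ij: "i \<in> S" "j \<in> S" "col i = col j" "i \<noteq> j"
    \<comment> \<open>Two equal columns would yield a nonzero kernel vector supported on
      \<open>S\<close>.\<close>
    have "A *v (axis i 1 - axis j 1) = 0"
      using ij(3) by (simp add: matrix_vector_mult_diff_distrib matrix_vector_mult_basis col_def)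
    then have "(axis i 1 - axis j 1 :: real ^ 'n) = 0"
      using ij(1,2) by (intro xker) (auto simp: S_def axis_def)
    then have "(axis i 1 - axis j 1 :: real ^ 'n) $ i = 0" by simp
    with ij(4) show False by (simp add: axis_def)
  qed
  have "independent (col ` S)"
    unfolding independent_explicit
  proof (intro conjI allI impI ballI)
    fix u v assume u: "(\<Sum>v\<in>col ` S. u v *\<^sub>R v) = 0" and "v \<in> col ` S"
    then obtain i where i: "i \<in> S" "v = col i" by blast
    define w where "w = (\<chi> j. if j \<in> S then u (col j) else 0)"
    have "A *v w = (\<Sum>j\<in>UNIV. (if j \<in> S then u (col j) else 0) *\<^sub>R col j)"
      by (simp add: matrix_mult_sum w_def col_def scalar_mult_eq_scaleR)
    also have "\<dots> = (\<Sum>j\<in>S. u (col j) *\<^sub>R col j)"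
      by (intro sum.mono_neutral_cong_right) auto
    also have "\<dots> = 0" using u injS by (simp add: sum.reindex)
    finally have "w = 0" by (rule xker) (simp add: w_def S_def)
    then have "w $ i = 0" by simp
    with i show "u v = 0" by (simp add: w_def)
  qed simp
  with ST obtain C where C: "col ` S \<subseteq> C" "C \<subseteq> col ` T" "independent C" "col ` T \<subseteq> span C"
    using maximal_independent_subset_extend[of "col ` S" "col ` T"] by blast
  have spanC: "span C = UNIV"
  proof (rule ccontr)
    assume "span C \<noteq> UNIV"
    then obtain d where d: "d \<noteq> 0" "span C \<subseteq> {v. d \<bullet> v = 0}"
      using span_not_univ_subset_hyperplane by blast
    \<comment> \<open>The normal of a hyperplane containing the span of \<open>C\<close> annihilates
      every active column, contrary to \<open>yker\<close>.\<close>
    have "(d v* A) $ j = 0" if "(y v* A) $ j = c $ j" for j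
      using that C(4) d(2) by (auto simp: vector_matrix_mult_column col_def T_def)
    then have "d = 0" by (rule yker)
    with d(1) show False by simp
  qed
  have cardC: "card C = CARD('m)"
    using dim_eq_card[of C UNIV] C(3) spanC by simp
  have "C - col ` S \<subseteq> col ` T" using C(2) by blast
  \<comment> \<open>Distinct indices may carry equal columns, so one index is selected for each
    column of \<open>C\<close> not already obtained from \<open>S\<close>.\<close>
  then obtain U where U: "U \<subseteq> T" "inj_on col U" "C - col ` S = col ` U"
    unfolding subset_image_inj by blast
  define B where "B = S \<union> U"
  have injB: "inj_on col B"
    using injS U(2,3) by (auto simp: B_def inj_on_Un)
  have imB: "col ` B = C"
    using C(1) U(3) by (auto simp: B_def image_Un)
  have cardB: "card B = CARD('m)"
    using card_image[OF injB] cardC imB by simp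
  have SB: "S \<subseteq> B" and BT: "B \<subseteq> T" using ST U(1) by (auto simp: B_def)
  define \<sigma> where "\<sigma> = (enum_of B :: 'm \<Rightarrow> 'n)"
  have \<sigma>: "bij_betw \<sigma> UNIV B" unfolding \<sigma>_def by (rule bij_betw_enum_of[OF cardB])
  define M where "M = sub_cols A B"
  have vM: "(z v* M) $ k = (z v* A) $ (\<sigma> k)" for z k
    by (simp add: M_def sub_cols_def \<sigma>_def vector_matrix_mult_def)
  \<comment> \<open>A kernel vector is orthogonal to all of \<open>C\<close>, which spans the
    space.\<close>
  have "invertible (transpose M)"
    unfolding invertible_left_inverse matrix_left_invertible_ker
  proof (intro allI impI)
    fix z assume "transpose M *v z = 0"
    then have zero: "(z v* M) $ k = 0" for k by simp
    have "z \<bullet> v = 0" if v: "v \<in> C" for v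
    proof -
      obtain j where j: "j \<in> B" "v = col j" using v imB by blast
      then obtain k where "j = \<sigma> k" using \<sigma> by (auto simp: bij_betw_def)
      moreover have "(z v* A) $ (\<sigma> k) = 0" using zero[of k] unfolding vM .
      ultimately show ?thesis using j(2) by (simp add: vector_matrix_mult_column col_def)
    qed
    then have "orthogonal z v" if "v \<in> C" for v using that by (simp add: orthogonal_def)
    then have "orthogonal z z"
      using orthogonal_to_span[of z C z] spanC by blast
    then show "z = 0" by (simp add: orthogonal_def)
  qed
  then have inv_t: "invertible (transpose M)" and inv: "invertible M"
    using transpose_invertible[of "transpose M"] by simp_all
  define xB where "xB = (\<chi> k. x $ \<sigma> k)"
  have "M *v xB = b"
  proof -
    have "(M *v xB) $ i = b $ i" for i
    proof -
      have "(M *v xB) $ i = (\<Sum>k\<in>UNIV. A $ i $ \<sigma> k * x $ \<sigma> k)"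
        by (simp add: M_def sub_cols_def \<sigma>_def xB_def matrix_vector_mult_def)
      also have "\<dots> = (\<Sum>j\<in>B. A $ i $ j * x $ j)"
        by (rule sum.reindex_bij_betw[OF \<sigma>])
      also have "\<dots> = (\<Sum>j\<in>UNIV. A $ i $ j * x $ j)"
        using SB by (intro sum.mono_neutral_left) (auto simp: S_def)
      also have "\<dots> = b $ i" using Ax(1) by (auto simp: matrix_vector_mult_def)
      finally show ?thesis .
    qed
    then show ?thesis by (simp add: vec_eq_iff)
  qed
  then have invb: "matrix_inv M *v b = xB"
    using matrix_inv_cancel(2)[OF inv] by (metis matrix_vector_mul_assoc matrix_vector_mul_lid)
  have yM: "y v* M = sub_vec c B"
    using BT \<sigma> by (auto simp: vec_eq_iff vM sub_vec_def T_def bij_betw_def simp flip: \<sigma>_def)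
  have yinv: "sub_vec c B v* matrix_inv M = y"
    using matrix_inv_cancel(1)[OF inv] unfolding yM[symmetric]
    by (simp add: vector_matrix_mul_assoc)
  show thesis
  proof
    show "optimal_basis A b c B"
      unfolding optimal_basis_def is_basis_def M_def[symmetric] invb yinv
      using cardB inv Ax(2) y by (simp add: xB_def less_eq_vec_def dual_opt_def)
    show "primal_sol A b B = x"
    proof -
      have "primal_sol A b B $ j = x $ j" for j
      proof (cases "j \<in> B")
        case True
        then have "\<sigma> (inv \<sigma> j) = j"
          using \<sigma> by (auto simp: bij_betw_def intro: f_inv_into_f)
        with True show ?thesis
          unfolding primal_sol_def M_def[symmetric] invb \<sigma>_def[symmetric] by (simp add: xB_def)
      next
        case False
        with SB show ?thesis by (auto simp: primal_sol_def S_def)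
      qed
      then show ?thesis by (simp add: vec_eq_iff)
    qed
    show "dual_sol A c B = y"
    proof -
      have "transpose M *v y = sub_vec c B" using yM by simp
      then show ?thesis
        unfolding dual_sol_def M_def[symmetric]
        using matrix_inv_cancel(2)[OF inv_t] by (metis matrix_vector_mul_assoc matrix_vector_mul_lid)
    qed
  qed
qed

text \<open>A nonzero \<open>d\<close> that leaves the active constraints unchanged would make
  \<open>y\<close> the midpoint of two dual optimal points. Thus the columns active at an extreme
  \<open>y\<close> span.\<close>

lemma extreme_dual_solution:
  fixes A :: "real ^ 'n ^ 'm"
  assumes ext: "y extreme_point_of (dual_opt A b c)"
    and d: "\<And>j. (y v* A) $ j = c $ j \<Longrightarrow> (d v* A) $ j = 0"
  shows "d = 0"
proof (rule ccontr)
  assume "d \<noteq> 0"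
  have y: "y v* A \<le> c" "lp_value A b c = ereal (b \<bullet> y)"
    using ext by (auto simp: extreme_point_of_def dual_opt_def)
  have neg: "(- d v* A) $ j = - (d v* A) $ j" for j
    by (simp add: vector_matrix_mult_column)
  have "\<forall>\<^sub>F e in at_right 0. (y + e *\<^sub>R d) v* A \<le> c"
    using d by (intro eventually_feasible_ray[OF y(1)]) simp
  moreover have "\<forall>\<^sub>F e in at_right 0. (y + e *\<^sub>R - d) v* A \<le> c"
    using d by (intro eventually_feasible_ray[OF y(1)]) (simp add: neg)
  ultimately have "\<forall>\<^sub>F e in at_right (0 :: real). 0 < e \<and> (y + e *\<^sub>R d) v* A \<le> c \<and> (y + e *\<^sub>R - d) v* A \<le> c"
    by (intro eventually_conj eventually_at_right_less)
  then obtain e where e: "0 < e" "(y + e *\<^sub>R d) v* A \<le> c" "(y + e *\<^sub>R - d) v* A \<le> c"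
    using eventually_happens'[OF trivial_limit_at_right_real] by blast
  \<comment> \<open>Neither of the two opposite directions can increase the objective beyond the
    optimum.\<close>
  have "b \<bullet> d = 0"
    using weak_duality[OF e(2), of b] weak_duality[OF e(3), of b] \<open>0 < e\<close>
    by (simp add: y(2) inner_add_right inner_diff_right mult_le_0_iff zero_le_mult_iff)
  then have "y + e *\<^sub>R d \<in> dual_opt A b c" "y + e *\<^sub>R - d \<in> dual_opt A b c"
    using e y(2) by (auto simp: dual_opt_def inner_add_right inner_diff_right)
  moreover have "y \<in> open_segment (y + e *\<^sub>R d) (y + e *\<^sub>R - d)"
  proof -
    have "midpoint (y + e *\<^sub>R d) (y + e *\<^sub>R - d) = y"
      by (simp add: midpoint_def flip: scaleR_2)
    moreover have "y + e *\<^sub>R d \<noteq> y + e *\<^sub>R - d"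
      using \<open>d \<noteq> 0\<close> \<open>0 < e\<close> by (simp add: eq_neg_iff_add_eq_0 flip: scaleR_2)
    ultimately show ?thesis
      using midpoint_in_open_segment by metis
  qed
  ultimately show False using ext by (auto simp: extreme_point_of_def)
qed

text \<open>Take an optimal \<open>x\<close> with the fewest nonzero entries. A kernel vector within
  its support would allow a move to a feasible point with smaller support, still optimal by
  complementary slackness.\<close>

lemma minimal_support_solution:
  fixes A :: "real ^ 'n ^ 'm"
  assumes y: "y \<in> dual_opt A b c" and nonempty: "primal_opt A b c \<noteq> {}"
  obtains x where "x \<in> primal_opt A b c"
    and "\<forall>u. A *v u = 0 \<longrightarrow> (\<forall>j. x $ j = 0 \<longrightarrow> u $ j = 0) \<longrightarrow> u = 0"
proof -
  obtain x where x: "x \<in> primal_opt A b c"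
    and min: "\<And>x'. x' \<in> primal_opt A b c \<Longrightarrow> card {j. x $ j \<noteq> 0} \<le> card {j. x' $ j \<noteq> 0}"
    using nonempty ex_has_least_nat[of "\<lambda>x. x \<in> primal_opt A b c" _ "\<lambda>x. card {j. x $ j \<noteq> 0}"]
    by blast
  have Ax: "A *v x = b" "0 \<le> x" using x by (auto simp: primal_opt_def)
  \<comment> \<open>Applied to both \<open>u\<close> and \<open>- u\<close> at the end, this gives
    \<open>u = 0\<close>.\<close>
  have nopos: "u $ j \<le> 0" if Au: "A *v u = 0" and supp: "\<And>j. x $ j = 0 \<Longrightarrow> u $ j = 0" for u j
  proof (rule ccontr)
    assume "\<not> u $ j \<le> 0"
    then have "0 < u $ j" by simp
    define J where "J = {j. 0 < u $ j}"
    \<comment> \<open>The ratio test: \<open>t\<close> is the largest step for which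
      \<open>x - t *\<^sub>R u\<close> stays nonnegative, and the minimising entry becomes
      zero.\<close>
    define t where "t = Min ((\<lambda>j. x $ j / u $ j) ` J)"
    have "J \<noteq> {}" using \<open>0 < u $ j\<close> by (auto simp: J_def)
    then have "t \<in> (\<lambda>j. x $ j / u $ j) ` J"
      unfolding t_def by (intro Min_in) auto
    then obtain i where i: "0 < u $ i" "t = x $ i / u $ i"
      by (auto simp: J_def)
    have xnn: "0 \<le> x $ j" for j using Ax(2) by (simp add: less_eq_vec_def)
    have "0 \<le> t" using i xnn by simp
    define x' where "x' = x - t *\<^sub>R u"
    have "0 \<le> x' $ j" for j
    proof (cases "0 < u $ j")
      case True
      then have "t \<le> x $ j / u $ j"
        unfolding t_def by (intro Min_le) (auto simp: J_def)
      with True show ?thesis by (simp add: x'_def pos_le_divide_eq)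
    next
      case False
      then have "t * u $ j \<le> 0" using \<open>0 \<le> t\<close> by (simp add: mult_nonneg_nonpos)
      with xnn[of j] show ?thesis by (simp add: x'_def)
    qed
    then have Ax': "A *v x' = b" "0 \<le> x'"
      using Ax(1) Au by (auto simp: x'_def less_eq_vec_def matrix_vector_mult_diff_distrib matrix_vector_mult_scaleR)
    have zero: "x' $ j = 0" if "x $ j = 0" for j
      using that supp[OF that] by (simp add: x'_def)
    have "x' \<in> primal_opt A b c"
      using complementary_slackness[OF y Ax] x complementary_slackness[OF y Ax'] zero by blast
    then have "card {j. x $ j \<noteq> 0} \<le> card {j. x' $ j \<noteq> 0}" by (rule min)
    moreover have "x' $ i = 0" using i by (simp add: x'_def)
    moreover have "x $ i \<noteq> 0" using supp[of i] i(1) by auto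
    ultimately show False
      using psubset_card_mono[of "{j. x $ j \<noteq> 0}" "{j. x' $ j \<noteq> 0}"] zero by fastforce
  qed
  show thesis
  proof (rule that[OF x], intro allI impI)
    fix u assume "A *v u = 0" "\<forall>j. x $ j = 0 \<longrightarrow> u $ j = 0"
    then have u: "A *v u = 0" "\<And>j. x $ j = 0 \<Longrightarrow> u $ j = 0" by simp_all
    have "A *v (- u) = 0"
      using u(1) matrix_vector_mult_scaleR[of A "-1" u] by simp
    then have "(- u) $ j \<le> 0" for j using u(2) by (intro nopos) auto
    with nopos[OF u] show "u = 0" by (auto simp: vec_eq_iff intro: antisym)
  qed
qed

section \<open>Convexity of the dual optimal set and of the sensitivity\<close>

lemma convex_dual_opt: "convex (dual_opt A b c)"
proof (rule convexI)
  fix y z and u v :: real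
  assume y: "y \<in> dual_opt A b c" and z: "z \<in> dual_opt A b c" and uv: "0 \<le> u" "0 \<le> v" "u + v = 1"
  have "b \<bullet> y = b \<bullet> z" using y z by (simp add: dual_opt_def)
  then have val: "b \<bullet> (u *\<^sub>R y + v *\<^sub>R z) = b \<bullet> z"
    using uv(3) by (simp add: inner_add_right flip: distrib_right)
  have "u * (y v* A) $ j + v * (z v* A) $ j \<le> c $ j" for j
    using y z uv convex_bound_le[of "(y v* A) $ j" "c $ j" "(z v* A) $ j" u v]
    by (simp add: dual_opt_def less_eq_vec_def)
  then show "u *\<^sub>R y + v *\<^sub>R z \<in> dual_opt A b c"
    using z val
    by (simp add: dual_opt_def less_eq_vec_def vector_matrix_left_distrib scaleR_vector_matrix_assoc)
qed

text \<open>For fixed \<open>x\<close> this is a sum of absolute values of the entries of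
  \<open>y\<close> with nonnegative weights \<open>A\<Delta> *v x + b\<Delta>\<close>, plus a
  constant.\<close>

lemma convex_sensitivity:
  fixes A\<Delta> :: "real ^ 'n ^ 'm"
  assumes "0 \<le> A\<Delta>" and "0 \<le> b\<Delta>" and "0 \<le> x" and "convex K"
  shows "convex_on K (sensitivity A\<Delta> b\<Delta> c\<Delta> x)"
proof (rule convex_onI)
  fix t :: real and y z :: "real ^ 'm"
  assume t: "0 < t" "t < 1"
  define w where "w = A\<Delta> *v x + b\<Delta>"
  have sens: "sensitivity A\<Delta> b\<Delta> c\<Delta> x q = \<bar>q\<bar> \<bullet> w + x \<bullet> c\<Delta>" for q
    by (simp add: sensitivity_def w_def inner_add_right)
  have "0 \<le> w"
    using matrix_mult_nonneg[OF assms(1,3)] assms(2) by (simp add: w_def)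
  moreover have "\<bar>(1 - t) *\<^sub>R y + t *\<^sub>R z\<bar> \<le> (1 - t) *\<^sub>R \<bar>y\<bar> + t *\<^sub>R \<bar>z\<bar>"
    using t abs_triangle_ineq[of "(1 - t) *\<^sub>R y" "t *\<^sub>R z"] by (simp add: abs_scaleR)
  ultimately have "\<bar>(1 - t) *\<^sub>R y + t *\<^sub>R z\<bar> \<bullet> w \<le> ((1 - t) *\<^sub>R \<bar>y\<bar> + t *\<^sub>R \<bar>z\<bar>) \<bullet> w"
    by (intro inner_mono_nonneg)
  then show "sensitivity A\<Delta> b\<Delta> c\<Delta> x ((1 - t) *\<^sub>R y + t *\<^sub>R z)
      \<le> (1 - t) * sensitivity A\<Delta> b\<Delta> c\<Delta> x y + t * sensitivity A\<Delta> b\<Delta> c\<Delta> x z"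
    by (simp add: sens inner_add_left algebra_simps)
qed (rule assms)

lemma basis_deriv_eq_sensitivity:
  "basis_deriv A b c A\<Delta> b\<Delta> c\<Delta> B = sensitivity A\<Delta> b\<Delta> c\<Delta> (primal_sol A b B) (dual_sol A c B)"
  by (simp add: basis_deriv_def sensitivity_def)

section \<open>From vertex pairs to the limit of the difference quotient\<close>

context regular_lp
begin

lemma dual_opt_convex_hull:
  "dual_opt A b c = convex hull {y. y extreme_point_of (dual_opt A b c)}"
  by (rule Krein_Milman_Minkowski[OF compact_dual_opt convex_dual_opt])

text \<open>One and the same \<open>x\<close> serves every extreme \<open>y\<close>, which allows
  maximising over \<open>y\<close> with \<open>x\<close> fixed.\<close>

lemma extreme_optimal_basis:
  obtains x where "x \<in> primal_opt A b c"
    and "\<forall>y. y extreme_point_of (dual_opt A b c) \<longrightarrow>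
      (\<exists>B. optimal_basis A b c B \<and> primal_sol A b B = x \<and> dual_sol A c B = y)"
proof -
  obtain y where y: "y \<in> dual_opt A b c" using dual_opt_nonempty by blast
  obtain x where x: "x \<in> primal_opt A b c"
      and ker: "\<forall>u. A *v u = 0 \<longrightarrow> (\<forall>j. x $ j = 0 \<longrightarrow> u $ j = 0) \<longrightarrow> u = 0"
    by (rule minimal_support_solution[OF y primal_opt_nonempty])
  show thesis
  proof (rule that[OF x], intro allI impI)
    fix y assume ext: "y extreme_point_of (dual_opt A b c)"
    then have yopt: "y \<in> dual_opt A b c" by (simp add: extreme_point_of_def)
    have "u = 0" if "A *v u = 0" "\<And>j. x $ j = 0 \<Longrightarrow> u $ j = 0" for u
      using ker that by blast
    from common_optimal_basis[OF x yopt this extreme_dual_solution[OF ext]]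
    show "\<exists>B. optimal_basis A b c B \<and> primal_sol A b B = x \<and> dual_sol A c B = y"
      by blast
  qed
qed

lemma optimal_basis_exists: "{B. optimal_basis A b c B} \<noteq> {}"
proof -
  have "{y. y extreme_point_of (dual_opt A b c)} \<noteq> {}"
    using dual_opt_nonempty dual_opt_convex_hull by (metis convex_hull_empty)
  then obtain y where "y extreme_point_of (dual_opt A b c)" by blast
  moreover obtain x where "\<forall>y. y extreme_point_of (dual_opt A b c) \<longrightarrow>
      (\<exists>B. optimal_basis A b c B \<and> primal_sol A b B = x \<and> dual_sol A c B = y)"
    by (rule extreme_optimal_basis)
  ultimately show ?thesis by blast
qed

text \<open>The minimum over \<open>x\<close> is at most the value at the fixed vertex. That value
  is convex in \<open>y\<close>, hence bounded by its values at the extreme dual solutions, each of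
  which is a \<open>basis_deriv\<close>.\<close>

lemma sensitivity_bound:
  assumes nonneg: "0 \<le> A\<Delta>" "0 \<le> b\<Delta>"
    and y: "y \<in> dual_opt A b c" and r: "\<forall>x\<in>primal_opt A b c. r \<le> sensitivity A\<Delta> b\<Delta> c\<Delta> x y"
  shows "r \<le> Max (basis_deriv A b c A\<Delta> b\<Delta> c\<Delta> ` {B. optimal_basis A b c B})" (is "r \<le> ?K")
proof -
  obtain x where x: "x \<in> primal_opt A b c"
      and basis: "\<forall>y. y extreme_point_of (dual_opt A b c) \<longrightarrow>
        (\<exists>B. optimal_basis A b c B \<and> primal_sol A b B = x \<and> dual_sol A c B = y)"
    by (rule extreme_optimal_basis)
  define E where "E = {y. y extreme_point_of (dual_opt A b c)}"
  have "sensitivity A\<Delta> b\<Delta> c\<Delta> x z \<le> ?K" if z: "z \<in> E" for z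
  proof -
    obtain B where B: "optimal_basis A b c B" "primal_sol A b B = x" "dual_sol A c B = z"
      using basis z by (auto simp: E_def)
    have "basis_deriv A b c A\<Delta> b\<Delta> c\<Delta> B \<le> ?K"
      using B(1) by (intro Max_ge) auto
    then show ?thesis by (simp add: basis_deriv_eq_sensitivity B)
  qed
  moreover have "convex_on (convex hull E) (sensitivity A\<Delta> b\<Delta> c\<Delta> x)"
    using x by (intro convex_sensitivity nonneg) (auto simp: primal_opt_def)
  ultimately have "\<forall>z\<in>convex hull E. sensitivity A\<Delta> b\<Delta> c\<Delta> x z \<le> ?K"
    by (intro convex_on_convex_hull_bound) auto
  then have "sensitivity A\<Delta> b\<Delta> c\<Delta> x y \<le> ?K"
    using y dual_opt_convex_hull by (simp add: E_def)
  then show ?thesis using r x by fastforce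
qed

text \<open>
  \<open>Sup R\<close> encodes \<open>max\<^sub>y min\<^sub>x sensitivity x y\<close> without having to know that the extrema are attained.
\<close>

lemma worst_quotient_tendsto:
  assumes nonneg: "0 \<le> A\<Delta>" "0 \<le> b\<Delta>" "0 \<le> c\<Delta>"
  defines "R \<equiv> {r. \<exists>y\<in>dual_opt A b c. \<forall>x\<in>primal_opt A b c. r \<le> sensitivity A\<Delta> b\<Delta> c\<Delta> x y}"
  shows "R \<noteq> {}" and "(worst_quotient A b c A\<Delta> b\<Delta> c\<Delta> \<longlongrightarrow> ereal (Sup R)) (at_right 0)"
proof -
  obtain f where f: "lp_value A b c = ereal f" by (rule finite_value)
  obtain y where y: "y \<in> dual_opt A b c" using dual_opt_nonempty by blast
  \<comment> \<open>Hence 0 belongs to \<open>R\<close>.\<close>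
  have "0 \<le> sensitivity A\<Delta> b\<Delta> c\<Delta> x y" if "x \<in> primal_opt A b c" for x
    using that nonneg
    by (auto simp: sensitivity_def primal_opt_def
        intro!: add_nonneg_nonneg inner_nonneg_vec matrix_mult_nonneg abs_vec_nonneg)
  then show "R \<noteq> {}" using y by (auto simp: R_def)
  have bdd: "bdd_above R"
    using sensitivity_bound[OF nonneg(1,2)] unfolding R_def by (intro bdd_aboveI) blast
  have pos: "\<forall>\<^sub>F \<alpha> in at_right (0 :: real). 0 < \<alpha>" by (rule eventually_at_right_less)
  show "(worst_quotient A b c A\<Delta> b\<Delta> c\<Delta> \<longlongrightarrow> ereal (Sup R)) (at_right 0)"
  proof (rule order_tendstoI)
    fix a assume "a < ereal (Sup R)"
    then obtain s where s: "a < ereal s" "s < Sup R"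
      using ereal_dense2 by (metis less_ereal.simps(1))
    then obtain r where r: "r \<in> R" "s < r"
      using less_cSupD[OF \<open>R \<noteq> {}\<close>] by blast
    then obtain z where z: "z \<in> dual_opt A b c"
        "\<And>x. x \<in> primal_opt A b c \<Longrightarrow> r \<le> sensitivity A\<Delta> b\<Delta> c\<Delta> x z"
      by (auto simp: R_def)
    \<comment> \<open>The tolerance \<open>r - s\<close> turns the slope \<open>r - e\<close> of the
      lower bound into \<open>s\<close>.\<close>
    have "0 < r - s" using r(2) by simp
    then have "\<forall>\<^sub>F \<alpha> in at_right 0. ereal (f + \<alpha> * (r - (r - s))) \<le> worst_value A b c A\<Delta> b\<Delta> c\<Delta> \<alpha>"
      using z by (intro eventually_worst_value_ge nonneg f)
    with pos show "\<forall>\<^sub>F \<alpha> in at_right 0. a < worst_quotient A b c A\<Delta> b\<Delta> c\<Delta> \<alpha>"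
    proof eventually_elim
      case (elim \<alpha>)
      then have "ereal s \<le> worst_quotient A b c A\<Delta> b\<Delta> c\<Delta> \<alpha>"
        unfolding worst_quotient_def f
        by (cases "worst_value A b c A\<Delta> b\<Delta> c\<Delta> \<alpha>") (auto simp: pos_le_divide_eq algebra_simps)
      with s(1) show ?case by (rule less_le_trans)
    qed
  next
    fix a assume "ereal (Sup R) < a"
    then obtain s where s: "ereal s < a" "Sup R < s"
      using ereal_dense2 by (metis less_ereal.simps(1))
    \<comment> \<open>With \<open>M = Sup R\<close> and this tolerance, the slope
      \<open>M + e\<close> of the upper bound is \<open>s\<close>.\<close>
    have "0 < s - Sup R" using s(2) by simp
    moreover have "r \<le> Sup R" if "z \<in> dual_opt A b c"
      "\<forall>x\<in>primal_opt A b c. r \<le> sensitivity A\<Delta> b\<Delta> c\<Delta> x z" for r z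
      using that by (intro cSup_upper bdd) (auto simp: R_def)
    ultimately have "\<forall>\<^sub>F \<alpha> in at_right 0. worst_value A b c A\<Delta> b\<Delta> c\<Delta> \<alpha>
        \<le> ereal (f + \<alpha> * (Sup R + (s - Sup R)))"
      by (rule eventually_worst_value_le[OF f])
    with pos show "\<forall>\<^sub>F \<alpha> in at_right 0. worst_quotient A b c A\<Delta> b\<Delta> c\<Delta> \<alpha> < a"
    proof eventually_elim
      case (elim \<alpha>)
      then have "worst_quotient A b c A\<Delta> b\<Delta> c\<Delta> \<alpha> \<le> ereal s"
        unfolding worst_quotient_def f
        by (cases "worst_value A b c A\<Delta> b\<Delta> c\<Delta> \<alpha>") (auto simp: pos_divide_le_eq algebra_simps)
      then show ?case using s(1) by (rule le_less_trans)
    qed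
  qed
qed

end

theorem proposition2:
  fixes A A\<Delta> :: "real ^ 'n ^ 'm" and b b\<Delta> :: "real ^ 'm" and c c\<Delta> :: "real ^ 'n"
  assumes "0 \<le> A\<Delta>" and "0 \<le> b\<Delta>" and "0 \<le> c\<Delta>"
    and "inj (\<lambda>i. row i A)" and "independent (range (\<lambda>i. row i A))"
    and "\<exists>x0. A *v x0 = b \<and> (\<forall>j. 0 < x0 $ j)"
    and "interior {y. transpose A *v y \<le> c} \<noteq> {}"
  shows "(worst_quotient A b c A\<Delta> b\<Delta> c\<Delta> \<longlongrightarrow> worst_deriv A b c A\<Delta> b\<Delta> c\<Delta>) (at_right 0)
    \<and> {B. optimal_basis A b c B} \<noteq> {}
    \<and> worst_deriv A b c A\<Delta> b\<Delta> c\<Delta>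
        \<le> ereal (Max (basis_deriv A b c A\<Delta> b\<Delta> c\<Delta> ` {B. optimal_basis A b c B}))"
proof -
  obtain x0 where x0: "A *v x0 = b" "\<And>j. 0 < x0 $ j" using assms(6) by blast
  obtain y0 where y0: "y0 \<in> interior {y. transpose A *v y \<le> c}" using assms(7) by blast
  then have "y0 v* A \<le> c" using interior_subset by fastforce
  then interpret regular_lp A b c x0 y0
    using assms(4,5) x0 interior_dual_strict[OF y0] by unfold_locales
  define R where "R = {r. \<exists>y\<in>dual_opt A b c. \<forall>x\<in>primal_opt A b c. r \<le> sensitivity A\<Delta> b\<Delta> c\<Delta> x y}"
  note lim = worst_quotient_tendsto[OF assms(1-3), folded R_def]
  \<comment> \<open>Convergence is already known, so \<open>Lim\<close> is the actual limit.\<close>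
  have deriv: "worst_deriv A b c A\<Delta> b\<Delta> c\<Delta> = ereal (Sup R)"
    unfolding worst_deriv_def by (rule tendsto_Lim[OF trivial_limit_at_right_real lim(2)])
  have "Sup R \<le> Max (basis_deriv A b c A\<Delta> b\<Delta> c\<Delta> ` {B. optimal_basis A b c B})"
    using lim(1) sensitivity_bound[OF assms(1,2)] by (intro cSup_least) (auto simp: R_def)
  with lim(2) optimal_basis_exists show ?thesis by (simp add: deriv)
qed

end
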